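(* (i) For every real $q$ with $0<q<1$, $$\frac{(q;q)_\infty^2\,(q^{7/6};q)_\infty^2}{(q^{1/2};q)_\infty(q^{3/2};q)_\infty(q^{2/3};q)_\infty(q^{5/3};q)_\infty} =\sum_{n=0}^{\infty}(-1)^n\frac{(q^{1/2},q,q^{2/3};q^{1/2})_n\,(q^{1/2};q)_n(q^{1/3};q)_n}{(q^{2/3};q)_n(q^{5/3};q)_n\,(q^{3/2};q^{1/2})_{3n}\,(1+q^{1/2})}$$ $$\times q^{\frac{n(9n+11)}{12}}\left\{q^{n+\frac12}+\frac{(1-q^{2n+1})(1-q^{\frac32n+\frac76})}{(1-q^{\frac n2+\frac12})(1-q^{n+\frac23})}\right\}.$$ (ii) The limiting case $q\to1$ gives $$\frac{48\pi\,\Gamma(\frac23)^2}{\Gamma(\frac16)^2}=\sum_{n=0}^{\infty}\left(\frac{-1}{27}\right)^n\frac{(1)_n(\frac12)_n(\frac13)_n}{(\frac53)_n^3}\,(9+28n+21n^2).$$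
   Context: For a base $p$: $(x;p)_0=1$, $(x;p)_n=\prod_{j=0}^{n-1}(1-p^jx)$, $(x;p)_\infty=\prod_{j\ge0}(1-p^jx)$, and $(x_1,\dots,x_r;p)_n=(x_1;p)_n\cdots(x_r;p)_n$. Fractional powers of $q$ are the positive real ones. $(x)_0=1$ and $(x)_n=x(x+1)\cdots(x+n-1)$ is the ordinary shifted factorial. *)

theory Defs
  imports "HOL-Analysis.Analysis"
begin

definition qpoch :: "real \<Rightarrow> real \<Rightarrow> nat \<Rightarrow> real" where
  "qpoch x p n = (\<Prod>j<n. 1 - p ^ j * x)"

definition qpoch_inf :: "real \<Rightarrow> real \<Rightarrow> real" where
  "qpoch_inf x p = (\<Prod>j. 1 - p ^ j * x)"

definition qpochs :: "real list \<Rightarrow> real \<Rightarrow> nat \<Rightarrow> real" where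
  "qpochs xs p n = (\<Prod>x\<leftarrow>xs. qpoch x p n)"

definition q_product :: "real \<Rightarrow> real" where
  "q_product q =
     (qpoch_inf q q)\<^sup>2 * (qpoch_inf (q powr (7/6)) q)\<^sup>2
     / (qpoch_inf (q powr (1/2)) q * qpoch_inf (q powr (3/2)) q
        * qpoch_inf (q powr (2/3)) q * qpoch_inf (q powr (5/3)) q)"

definition q_term :: "real \<Rightarrow> nat \<Rightarrow> real" where
  "q_term q n =
     (-1) ^ n
     * (qpochs [q powr (1/2), q, q powr (2/3)] (q powr (1/2)) n
        * qpoch (q powr (1/2)) q n * qpoch (q powr (1/3)) q n)
     / (qpoch (q powr (2/3)) q n * qpoch (q powr (5/3)) q n
        * qpoch (q powr (3/2)) (q powr (1/2)) (3 * n) * (1 + q powr (1/2)))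
     * q powr (real n * (9 * real n + 11) / 12)
     * (q powr (real n + 1/2)
        + (1 - q ^ (2 * n + 1)) * (1 - q powr (3/2 * real n + 7/6))
          / ((1 - q powr (real n / 2 + 1/2)) * (1 - q powr (real n + 2/3))))"

(* As q tends to 1 from below, 4 * q_term q n tends to classical_term n. *)
definition classical_term :: "nat \<Rightarrow> real" where
  "classical_term n =
     (-1/27) ^ n
     * (pochhammer 1 n * pochhammer (1/2) n * pochhammer (1/3) n)
     / (pochhammer (5/3) n) ^ 3
     * (9 + 28 * real n + 21 * (real n)\<^sup>2)"

end

(*
Put s = q^(1/2), e = q^(1/3), z = q^(2/3).  Up to a factor the product is the nonterminating
6-phi-5 sum with parameters a = q, b = c = s, d = e, so it equals sum_k F(0,k), where F(0,k) is a
multiple of (1 + s q^k)/(1 - s q^k) (e;q)_k / (q z;q)_k z^k.  Following Chu, one accelerates this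
sum by the parameter shift a -> q^2 a, {s^(n+1), s^(n+2)} -> {s^(n+2), s^(n+3)}, d -> q d, e -> q e;
the two middle parameters differ by the factor s, so that half-integral shifts are possible and
produce the base q^(1/2).  This gives F(n,k) with F(n,k) - F(n+1,k) = G(n,k) - G(n,k+1), and
summation over n and k yields sum_k F(0,k) = sum_n G(n,0), the series of the theorem.
The 6-phi-5 sum itself follows in the same way from the shift a -> q a.

For q -> 1 the terms of the series are at most 9/3^n for every q, so Tannery's theorem applies;
the partial products increase with n and are bounded by their values at q = 1.
*)
theory Submission
  imports Defs
begin


section \<open>q-shifted factorials\<close>

text \<open>The acceleration is carried out for real s, e, z tied only by e z = s^2 and a few
  inequalities; the sixth root v of q, with s = v^3, e = v^2, z = v^4, enters only to match the
  fractional powers of the theorem. In X = q^(n/2) and y = q^k each telescoping relation becomes a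
  polynomial identity once a common denominator is cleared. No double series is rearranged: with
  S(n) = sum_k F(n,k), telescoping in k gives S(n) - S(n+1) = G(n,0), and S(n) tends to 0. The
  factor 3^(-n) thus serves twice, to remove this remainder and to dominate the series as q -> 1.
  The product splits into two quotients of the form (q^c;q)^2 / ((q^(c-1/2);q) (q^(c+1/2);q)), for c
  = 1 and c = 7/6. The exponents on both sides of such a quotient have the same sum, so it converges
  as q -> 1 without any normalising power of 1 - q, and no q-Gamma function is required.\<close>

lemma qpoch_0 [simp]: "qpoch x p 0 = 1"
  by (simp add: qpoch_def)

lemma qpoch_Suc: "qpoch x p (Suc n) = qpoch x p n * (1 - p ^ n * x)"
  by (simp add: qpoch_def)

lemma qpoch_Suc_left: "qpoch x p (Suc n) = (1 - x) * qpoch (p * x) p n"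
  by (simp add: qpoch_def prod.lessThan_Suc_shift mult_ac del: prod.lessThan_Suc)

lemma qpoch_shift: "(1 - x) * qpoch (p * x) p n = qpoch x p n * (1 - p ^ n * x)"
  using qpoch_Suc qpoch_Suc_left by metis

lemma power_mult_less_1:
  fixes x p :: real
  assumes "0 \<le> p" "p \<le> 1" "0 \<le> x" "x < 1"
  shows "p ^ n * x < 1"
  using assms mult_left_le_one_le[of x "p ^ n"] by (simp add: power_le_one)

lemma qpoch_pos:
  assumes "0 \<le> p" "p \<le> 1" "0 \<le> x" "x < 1"
  shows "0 < qpoch x p n"
  unfolding qpoch_def using power_mult_less_1[OF assms] by (intro prod_pos) auto

lemma qpoch_nonneg:
  assumes "0 \<le> p" "p \<le> 1" "0 \<le> x" "x \<le> 1"
  shows "0 \<le> qpoch x p n"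
  unfolding qpoch_def using assms by (intro prod_nonneg) (auto simp: mult_le_one power_le_one)

lemma qpoch_antimono:
  assumes "0 \<le> p" "p \<le> 1" "0 \<le> x" "x \<le> y" "y \<le> 1"
  shows "qpoch y p n \<le> qpoch x p n"
  unfolding qpoch_def using assms
  by (intro prod_mono) (auto simp: mult_le_one power_le_one mult_left_mono)

lemma qpoch_le_1:
  assumes "0 \<le> p" "p \<le> 1" "0 \<le> x" "x \<le> 1"
  shows "qpoch x p n \<le> 1"
  using qpoch_antimono[of p 0 x n] assms by (simp add: qpoch_def)

lemma convergent_prod_qpoch:
  fixes x p :: real
  assumes "0 \<le> p" "p < 1"
  shows "convergent_prod (\<lambda>j. 1 - p ^ j * x)"
proof (rule abs_convergent_prod_imp_convergent_prod, rule summable_imp_abs_convergent_prod)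
  have "summable (\<lambda>j. p ^ j * \<bar>x\<bar>)"
    using assms by (intro summable_mult2 summable_geometric) auto
  thus "summable (\<lambda>j. norm (1 - p ^ j * x - 1))"
    using assms by (simp add: abs_mult)
qed

lemma qpoch_LIMSEQ:
  assumes "0 \<le> p" "p < 1"
  shows "qpoch x p \<longlonglongrightarrow> qpoch_inf x p"
proof -
  have "(\<lambda>n. qpoch x p (Suc n)) \<longlonglongrightarrow> qpoch_inf x p"
    using convergent_prod_LIMSEQ[OF convergent_prod_qpoch[OF assms]]
    by (simp add: qpoch_def qpoch_inf_def lessThan_Suc_atMost)
  thus ?thesis by (simp add: filterlim_sequentially_Suc)
qed

lemma qpoch_inf_pos:
  assumes "0 \<le> p" "p < 1" "0 \<le> x" "x < 1"
  shows "0 < qpoch_inf x p"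
  unfolding qpoch_inf_def using assms power_mult_less_1[of p x]
  by (intro less_0_prodinf convergent_prod_qpoch) auto

lemma qpoch_inf_le_qpoch:
  assumes "0 \<le> p" "p < 1" "0 \<le> x" "x < 1"
  shows "qpoch_inf x p \<le> qpoch x p n"
  unfolding qpoch_inf_def qpoch_def using assms power_mult_less_1[of p x]
  by (intro prod_ge_prodinf[OF convergent_prod_has_prod[OF convergent_prod_qpoch]])
     (auto simp: less_imp_le)

lemma qpoch_inf_rec:
  assumes "0 \<le> p" "p < 1"
  shows "qpoch_inf x p = (1 - x) * qpoch_inf (p * x) p"
proof (rule LIMSEQ_unique)
  show "(\<lambda>n. qpoch x p (Suc n)) \<longlonglongrightarrow> qpoch_inf x p"
    using qpoch_LIMSEQ[OF assms] by (simp add: filterlim_sequentially_Suc)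
  show "(\<lambda>n. qpoch x p (Suc n)) \<longlonglongrightarrow> (1 - x) * qpoch_inf (p * x) p"
    unfolding qpoch_Suc_left by (intro tendsto_intros qpoch_LIMSEQ assms)
qed

section \<open>The nonterminating 6-phi-5 sum\<close>

text \<open>
  With \<open>q a = z b c d\<close> the denominator parameters \<open>a q / b\<close>, \<open>a q / c\<close>, \<open>a q / d\<close> are
  \<open>z c d\<close>, \<open>z b d\<close>, \<open>z b c\<close>, and \<open>a q / (b c)\<close> is \<open>z d\<close>. This avoids all divisions.
\<close>

definition phi65_coeff :: "real \<Rightarrow> real \<Rightarrow> real \<Rightarrow> real \<Rightarrow> real \<Rightarrow> real \<Rightarrow> nat \<Rightarrow> real" where
  "phi65_coeff q a b c d z k =
     (qpoch a q k * qpoch b q k * qpoch c q k * qpoch d q k)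
     / (qpoch q q k * qpoch (z * c * d) q k * qpoch (z * b * d) q k * qpoch (z * b * c) q k)"

text \<open>The factor (1 - a q^(2k)) / (1 - a) is the very-well-poised pair of parameters q
  sqrt(a), -q sqrt(a) over sqrt(a), -sqrt(a) in closed form, which avoids the square root.\<close>

definition phi65_term :: "real \<Rightarrow> real \<Rightarrow> real \<Rightarrow> real \<Rightarrow> real \<Rightarrow> real \<Rightarrow> nat \<Rightarrow> real" where
  "phi65_term q a b c d z k = (1 - a * (q ^ k)\<^sup>2) / (1 - a) * phi65_coeff q a b c d z k * z ^ k"

text \<open>This is \<open>phi65_term_telescope\<close> with denominators cleared and y = q^k. There
  q survives only in q a, which is replaced by z b c d, so the six variables left are
  independent.\<close>

lemma phi65_polynomial_identity:
  fixes a b c d y z :: real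
  shows "(1 - z) * (1 - a * y\<^sup>2) * ((1 - z*c*d * y) * (1 - z*b*d * y) * (1 - z*b*c * y))
       - (1 - z*b) * (1 - z*c) * (1 - z*d) * ((1 - z*b*c*d * y\<^sup>2) * (1 - a * y) * y)
       = (1 - y) * (1 - a * z * y) * ((1 - z*c*d * y) * (1 - z*b*d * y) * (1 - z*b*c * y))
         - z * ((1 - a * y) * (1 - b * y) * (1 - c * y) * (1 - d * y) * (1 - z*b*c*d * z * y))"
  by algebra

text \<open>The shift a -> q a, z -> q z keeps the balance q a = z b c d for fixed b, c, d.
  \<open>C\<close> collects the factors with j = 0 of the infinite products in
  \<open>phi65_sums\<close>, and \<open>g\<close> is the telescoping certificate.\<close>

lemma phi65_term_telescope:
  fixes q a b c d z :: real and k :: nat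
  defines "C \<equiv> (1 - q * a) * (1 - z * b) * (1 - z * c) * (1 - z * d)
                 / ((1 - z * c * d) * (1 - z * b * d) * (1 - z * b * c) * (1 - z))"
  defines "g \<equiv> \<lambda>k. (1 - q ^ k) * (1 - a * z * q ^ k) / ((1 - a) * (1 - z)) * phi65_coeff q a b c d z k * z ^ k"
  assumes q: "0 < q" "q < 1" and a: "0 < a" "a < 1" and bcd: "0 < b" "b < 1" "0 < c" "c < 1" "0 < d" "d < 1"
    and z: "0 < z" "z < 1" and bal: "q * a = z * b * c * d"
  shows "phi65_term q a b c d z k - C * phi65_term q (q * a) b c d (q * z) k = g k - g (Suc k)"
proof -
  define y where "y = q ^ k"
  define M where "M = (qpoch a q k * qpoch b q k * qpoch c q k * qpoch d q k)
     / (qpoch q q k * qpoch (z * c * d) q k * qpoch (z * b * d) q k * qpoch (z * b * c) q k) * z ^ k"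
  have y: "0 < y" "y \<le> 1" using q by (auto simp: y_def power_le_one)
  have m1: "u * v < 1" if "0 < u" "u < 1" "0 < v" "v \<le> 1" for u v :: real
    using that mult_left_le[of v u] by linarith
  have zz: "z*c*d < 1" "z*b*d < 1" "z*b*c < 1" "z*b < 1" "z*c < 1" "z*d < 1"
    using bcd z by (auto intro!: m1 mult_pos_pos)
  have zp: "0 < z*c*d" "0 < z*b*d" "0 < z*b*c" using bcd z by auto
  have yy: "z*c*d*y < 1" "z*b*d*y < 1" "z*b*c*y < 1"
    using zz zp y by (auto intro!: m1)
  have qa: "q * a < 1" using m1[of q a] q a by simp
  have qy: "q * y < 1" using m1[of q y] q y by simp
  have nz: "qpoch q q k \<noteq> 0" "qpoch (z*c*d) q k \<noteq> 0" "qpoch (z*b*d) q k \<noteq> 0" "qpoch (z*b*c) q k \<noteq> 0"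
    using q zz zp qpoch_pos[of q] by (auto simp: less_le[of 0])
  have sh: "qpoch (q * x) q k = qpoch x q k * (1 - y * x) / (1 - x)" if "x < 1" for x
    using qpoch_shift[of x q k] that by (simp add: y_def field_simps)
  define N where "N = (1 - z*c*d*y) * (1 - z*b*d*y) * (1 - z*b*c*y)"
  have N: "N \<noteq> 0" using yy by (simp add: N_def)
  define D where "D = (1 - a) * (1 - z) * N"
  have D: "D \<noteq> 0" using N a z by (simp add: D_def)
  have 1: "phi65_term q a b c d z k = M * ((1 - z) * (1 - a * y\<^sup>2) * N) / D"
    using N z by (simp add: phi65_term_def phi65_coeff_def M_def D_def y_def mult_ac)
  have e: "q * z * c * d = q * (z*c*d)" "q * z * b * d = q * (z*b*d)" "q * z * b * c = q * (z*b*c)"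
    by simp_all
  have "phi65_term q (q * a) b c d (q * z) k =
        M * ((1 - z*b*c*d * y\<^sup>2) * (1 - a * y) * y) * ((1 - z*c*d) * (1 - z*b*d) * (1 - z*b*c)) / ((1 - q * a) * (1 - a) * N)"
    unfolding phi65_term_def phi65_coeff_def e sh[OF a(2)] sh[OF zz(1)] sh[OF zz(2)] sh[OF zz(3)] power_mult_distrib y_def[symmetric]
    using zz(1-3) yy N a qa unfolding bal by (simp add: M_def N_def mult_ac)
  hence 2: "C * phi65_term q (q * a) b c d (q * z) k =
        M * ((1 - z*b) * (1 - z*c) * (1 - z*d) * ((1 - z*b*c*d * y\<^sup>2) * (1 - a * y) * y)) / D"
    unfolding C_def D_def using zz(1-3) qa a z N by (simp add: mult_ac)
  have 3: "g k = M * ((1 - y) * (1 - a * z * y) * N) / D"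
    using N by (simp add: g_def phi65_coeff_def M_def D_def y_def mult_ac)
  have 4: "g (Suc k) = M * (z * ((1 - a * y) * (1 - b * y) * (1 - c * y) * (1 - d * y) * (1 - z*b*c*d * z * y))) / D"
  proof -
    have "g (Suc k) = (1 - q * y) * (1 - q * a * z * y) / ((1 - a) * (1 - z)) 
        * (M * ((1 - a * y) * (1 - b * y) * (1 - c * y) * (1 - d * y) / ((1 - q * y) * N) * z))"
      by (simp add: g_def phi65_coeff_def qpoch_Suc y_def[symmetric] M_def N_def mult_ac)
    also have "\<dots> = M * (z * ((1 - a * y) * (1 - b * y) * (1 - c * y) * (1 - d * y) * (1 - q * a * z * y))) / D"
      unfolding D_def using qy by (simp add: mult_ac)
    finally show ?thesis unfolding bal .
  qed
  show ?thesis
    unfolding 1 2 3 4 using phi65_polynomial_identity[of z a y c d b] 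
    unfolding N_def[symmetric] diff_divide_distrib[symmetric] right_diff_distrib[symmetric] by simp
qed

text \<open>The bound is free of a, k and z, so it serves all the shifted series with z replaced by
  q^m z at once.\<close>

lemma phi65_coeff_bounds:
  fixes q a b c d z z0 :: real
  assumes q: "0 < q" "q < 1" and a: "0 < a" "a < 1" and bcd: "0 < b" "b < 1" "0 < c" "c < 1" "0 < d" "d < 1"
    and z: "0 < z" "z \<le> z0" "z0 < 1"
  shows "0 \<le> phi65_coeff q a b c d z k"
    and "phi65_coeff q a b c d z k \<le> 1 / (qpoch_inf q q * qpoch_inf (z0 * c * d) q * qpoch_inf (z0 * b * d) q * qpoch_inf (z0 * b * c) q)"
proof -
  have m1: "z0 * u * v < 1" if "0 < u" "u < 1" "0 < v" "v < 1" for u v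
  proof -
    have "u * v < 1 * 1" using that by (intro mult_strict_mono) auto
    hence "z0 * (u * v) < 1 * 1" using that z by (intro mult_strict_mono) auto
    thus ?thesis by (simp add: mult_ac)
  qed
  have den: "0 < qpoch_inf (z0 * u * v) q \<and> qpoch_inf (z0 * u * v) q \<le> qpoch (z * u * v) q k"
    if "0 < u" "u < 1" "0 < v" "v < 1" for u v
  proof
    show "0 < qpoch_inf (z0 * u * v) q" using q z that m1[OF that] by (intro qpoch_inf_pos) auto
    have "qpoch_inf (z0 * u * v) q \<le> qpoch (z0 * u * v) q k"
      using q z that m1[OF that] by (intro qpoch_inf_le_qpoch) auto
    also have "\<dots> \<le> qpoch (z * u * v) q k"
      using q z that m1[OF that] by (intro qpoch_antimono) (auto simp: mult_right_mono)
    finally show "qpoch_inf (z0 * u * v) q \<le> qpoch (z * u * v) q k" .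
  qed
  have num: "0 \<le> qpoch x q k \<and> qpoch x q k \<le> 1" if "0 < x" "x < 1" for x
    using q that by (auto intro: qpoch_nonneg qpoch_le_1)
  have "0 < qpoch_inf q q" "qpoch_inf q q \<le> qpoch q q k"
    using q by (auto intro: qpoch_inf_pos qpoch_inf_le_qpoch)
  note pos = this den[OF bcd(3-6)] den[OF bcd(1,2,5,6)] den[OF bcd(1-4)]
  show "0 \<le> phi65_coeff q a b c d z k"
    unfolding phi65_coeff_def using pos num[OF a] num[OF bcd(1,2)] num[OF bcd(3,4)] num[OF bcd(5,6)]
    by (intro divide_nonneg_nonneg mult_nonneg_nonneg) auto
  show "phi65_coeff q a b c d z k \<le> 1 / (qpoch_inf q q * qpoch_inf (z0 * c * d) q * qpoch_inf (z0 * b * d) q * qpoch_inf (z0 * b * c) q)"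
    unfolding phi65_coeff_def using pos num[OF a] num[OF bcd(1,2)] num[OF bcd(3,4)] num[OF bcd(5,6)]
    by (intro frac_le mult_mono mult_le_one mult_pos_pos) auto
qed

text \<open>After M shifts the sum equals the M-th partial product of the claimed value times the
  same sum with q^M a and q^M z. Since q^M z tends to 0, only the term k = 0 of the latter survives,
  and it is 1.\<close>

theorem phi65_sums:
  fixes q a b c d z :: real
  assumes q: "0 < q" "q < 1" and a: "0 < a" "a < 1" and bcd: "0 < b" "b < 1" "0 < c" "c < 1" "0 < d" "d < 1"
    and z: "0 < z" "z < 1" and bal: "q * a = z * b * c * d"
  shows "phi65_term q a b c d z sums
           (qpoch_inf (q * a) q * qpoch_inf (z * b) q * qpoch_inf (z * c) q * qpoch_inf (z * d) q
            / (qpoch_inf (z * c * d) q * qpoch_inf (z * b * d) q * qpoch_inf (z * b * c) q * qpoch_inf z q))"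
    (is "_ sums ?P")
proof -
  define K where "K = 1 / (qpoch_inf q q * qpoch_inf (z * c * d) q * qpoch_inf (z * b * d) q * qpoch_inf (z * b * c) q)"
  define T where "T = (\<lambda>m. phi65_term q (q ^ m * a) b c d (q ^ m * z))"
  define C where "C = (\<lambda>m. (1 - q * (q ^ m * a)) * (1 - q ^ m * z * b) * (1 - q ^ m * z * c) * (1 - q ^ m * z * d)
                 / ((1 - q ^ m * z * c * d) * (1 - q ^ m * z * b * d) * (1 - q ^ m * z * b * c) * (1 - q ^ m * z)))"
  have qm: "0 < q ^ m" "q ^ m \<le> 1" for m using q by (auto simp: power_le_one)
  have am: "0 < q ^ m * a" "q ^ m * a \<le> a" "q ^ m * a < 1" for m
  proof -
    show "q ^ m * a \<le> a" using a qm[of m] mult_left_le_one_le[of a "q ^ m"] by simp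
    thus "q ^ m * a < 1" using a(2) by linarith
    show "0 < q ^ m * a" using a(1) qm(1) by simp
  qed
  have zm: "0 < q ^ m * z" "q ^ m * z \<le> z" "q ^ m * z < 1" for m
  proof -
    show "q ^ m * z \<le> z" using z qm[of m] mult_left_le_one_le[of z "q ^ m"] by simp
    thus "q ^ m * z < 1" using z(2) by linarith
    show "0 < q ^ m * z" using z(1) qm(1) by simp
  qed
  have co: "0 \<le> phi65_coeff q (q ^ m * a) b c d (q ^ m * z) k" "phi65_coeff q (q ^ m * a) b c d (q ^ m * z) k \<le> K" for m k
    unfolding K_def using phi65_coeff_bounds[OF q am(1,3) bcd zm(1,2) z(2)] by auto
  have K: "0 \<le> K" using co order_trans by blast
  have coz: "\<bar>phi65_coeff q (q ^ m * a) b c d (q ^ m * z) k * (q ^ m * z) ^ k\<bar> \<le> K * (q ^ m * z) ^ k" for m k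
    using co[of m k] zm(1)[of m] by (simp add: abs_mult mult_right_mono)
  have T_bound: "\<bar>T m k\<bar> \<le> K / (1 - a) * (q ^ m * z) ^ k" for m k
  proof -
    have "\<bar>1 - q ^ m * a * (q ^ k)\<^sup>2\<bar> \<le> 1"
      using am[of m] qm[of k] mult_left_le[of "(q ^ k)\<^sup>2" "q ^ m * a"] by (auto simp: abs_le_iff power_le_one)
    hence "\<bar>(1 - q ^ m * a * (q ^ k)\<^sup>2) / (1 - q ^ m * a)\<bar> \<le> 1 / (1 - a)"
      using am[of m] a by (simp only: abs_divide) (intro frac_le, auto)
    hence "\<bar>(1 - q ^ m * a * (q ^ k)\<^sup>2) / (1 - q ^ m * a)\<bar> *
            \<bar>phi65_coeff q (q ^ m * a) b c d (q ^ m * z) k * (q ^ m * z) ^ k\<bar> \<le> 1 / (1 - a) * (K * (q ^ m * z) ^ k)"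
      using a by (intro mult_mono coz) auto
    thus ?thesis by (simp add: T_def phi65_term_def abs_mult mult_ac)
  qed
  have T_bound': "\<bar>T m k\<bar> \<le> K / (1 - a) * z ^ k" for m k
  proof -
    have "(q ^ m * z) ^ k \<le> z ^ k" using zm[of m] by (intro power_mono) auto
    hence "K / (1 - a) * (q ^ m * z) ^ k \<le> K / (1 - a) * z ^ k"
      using K a by (intro mult_left_mono) auto
    thus ?thesis using T_bound[of m k] by linarith
  qed
  have geo: "summable (\<lambda>k. K / (1 - a) * z ^ k)"
    using z by (intro summable_mult summable_geometric) auto
  have T_summable: "summable (T m)" for m
    using T_bound' by (intro summable_comparison_test'[OF geo, of 0]) auto
  have rec: "suminf (T m) = C m * suminf (T (Suc m))" for m
  proof -
    define g where "g = (\<lambda>k. (1 - q ^ k) * (1 - q ^ m * a * (q ^ m * z) * q ^ k) / ((1 - q ^ m * a) * (1 - q ^ m * z))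
       * phi65_coeff q (q ^ m * a) b c d (q ^ m * z) k * (q ^ m * z) ^ k)"
    have step: "T m k - C m * T (Suc m) k = g k - g (Suc k)" for k
    proof -
      have "q * (q ^ m * a) = q ^ m * z * b * c * d" using bal by (simp add: mult_ac)
      from phi65_term_telescope[OF q am(1,3)[of m] bcd zm(1,3)[of m] this, of k]
      show ?thesis by (simp add: T_def C_def g_def mult_ac)
    qed
    have "(\<lambda>k. phi65_coeff q (q ^ m * a) b c d (q ^ m * z) k * (q ^ m * z) ^ k) \<longlonglongrightarrow> 0"
    proof (rule Lim_null_comparison)
      show "\<forall>\<^sub>F k in sequentially. norm (phi65_coeff q (q ^ m * a) b c d (q ^ m * z) k * (q ^ m * z) ^ k) \<le> K * (q ^ m * z) ^ k"
        using coz by (intro always_eventually allI) auto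
      show "(\<lambda>k. K * (q ^ m * z) ^ k) \<longlonglongrightarrow> 0"
        using zm[of m] by (intro tendsto_mult_right_zero LIMSEQ_power_zero) auto
    qed
    moreover have "(\<lambda>k. (1 - q ^ k) * (1 - q ^ m * a * (q ^ m * z) * q ^ k) / ((1 - q ^ m * a) * (1 - q ^ m * z)))
          \<longlonglongrightarrow> (1 - 0) * (1 - q ^ m * a * (q ^ m * z) * 0) / ((1 - q ^ m * a) * (1 - q ^ m * z))"
      using q am[of m] zm[of m] by (intro tendsto_intros LIMSEQ_power_zero) auto
    ultimately have "g \<longlonglongrightarrow> 0"
      unfolding g_def mult.assoc[of "_ / _"] by (auto dest: tendsto_mult)
    \<comment> \<open>The boundary value g 0 vanishes because of its factor 1 - q^0.\<close>
    from telescope_sums'[OF this] have "(\<lambda>k. T m k - C m * T (Suc m) k) sums 0"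
      unfolding step by (simp add: g_def)
    moreover have "(\<lambda>k. T m k - C m * T (Suc m) k) sums (suminf (T m) - C m * suminf (T (Suc m)))"
      by (intro sums_diff sums_mult summable_sums T_summable)
    ultimately show ?thesis using sums_unique2 by force
  qed
  have iter: "suminf (T 0) = (\<Prod>m<M. C m) * suminf (T M)" for M
  proof (induction M)
    case (Suc M)
    thus ?case using rec[of M] by (simp add: mult_ac)
  qed simp
  have prodC: "(\<Prod>m<M. C m) = qpoch (q * a) q M * qpoch (z * b) q M * qpoch (z * c) q M * qpoch (z * d) q M
      / (qpoch (z * c * d) q M * qpoch (z * b * d) q M * qpoch (z * b * c) q M * qpoch z q M)" for M
    unfolding C_def qpoch_def prod_dividef prod.distrib by (simp add: mult_ac)
  have m1: "z * u < 1" if "0 < u" "u < 1" for u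
    using mult_left_le[of u z] that z by linarith
  have m2: "z * u * v < 1" if "0 < u" "u < 1" "0 < v" "v < 1" for u v
    using mult_left_le[of v "z * u"] m1[OF that(1,2)] that z mult_pos_pos[of z u] by linarith
  have ne: "qpoch_inf (z * c * d) q * qpoch_inf (z * b * d) q * qpoch_inf (z * b * c) q * qpoch_inf z q \<noteq> 0"
    using q z bcd m2 by (intro no_zero_divisors less_imp_neq[symmetric] qpoch_inf_pos) (auto simp: mult_pos_pos less_imp_le)
  have limC: "(\<lambda>M. \<Prod>m<M. C m) \<longlonglongrightarrow> ?P"
    unfolding prodC using q ne by (intro tendsto_intros qpoch_LIMSEQ) auto
  \<comment> \<open>The term with index k is O((q^M z)^k), and the geometric majorant in z does not
    depend on M, so the limit may be taken term by term.\<close>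
  have limS: "(\<lambda>M. suminf (T M)) \<longlonglongrightarrow> (\<Sum>k. if k = 0 then 1 else 0)"
  proof (rule conjunct2[OF conjunct2[OF tannerys_theorem[where M = "\<lambda>k. K / (1 - a) * z ^ k"]]])
    show "(\<lambda>M. T M k) \<longlonglongrightarrow> (if k = 0 then 1 else 0)" for k
    proof (cases "k = 0")
      case True
      have "T m 0 = 1" for m using am[of m] by (simp add: T_def phi65_term_def phi65_coeff_def)
      thus ?thesis using True by simp
    next
      case False
      have "(\<lambda>M. K / (1 - a) * (q ^ M * z) ^ k) \<longlonglongrightarrow> K / (1 - a) * (0 * z) ^ k"
        using q by (intro tendsto_intros LIMSEQ_power_zero) auto
      hence "(\<lambda>M. K / (1 - a) * (q ^ M * z) ^ k) \<longlonglongrightarrow> 0" using False by (simp add: power_0_left)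
      hence "(\<lambda>M. T M k) \<longlonglongrightarrow> 0"
        by (rule Lim_null_comparison[rotated]) (use T_bound in auto)
      thus ?thesis using False by simp
    qed
    show "\<forall>\<^sub>F (k, M) in sequentially \<times>\<^sub>F sequentially. norm (T M k) \<le> K / (1 - a) * z ^ k"
      using T_bound' by (intro always_eventually) auto
  qed (use geo in auto)
  have "(\<lambda>M. (\<Prod>m<M. C m) * suminf (T M)) \<longlonglongrightarrow> ?P * (\<Sum>k. if k = 0 then 1 else 0)"
    by (intro tendsto_mult limC limS)
  hence "suminf (T 0) = ?P * (\<Sum>k::nat. if k = 0 then 1 else 0)"
    unfolding iter[symmetric] by (rule LIMSEQ_unique[OF tendsto_const])
  moreover have "(\<Sum>k::nat. if k = 0 then 1 else 0 :: real) = 1"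
    using suminf_finite[of "{0::nat}" "\<lambda>k. if k = 0 then 1 else (0::real)"] by simp
  ultimately have "suminf (T 0) = ?P" by simp
  thus ?thesis using summable_sums[OF T_summable[of 0]] by (simp add: T_def)
qed

section \<open>A WZ pair\<close>

text \<open>The part of the summand outside the braces, encoded by the ratios of consecutive terms.
  Both bases s and s^2, the index 3n and the quadratic power of q then become rational expressions
  in X = q^(j/2).\<close>

definition acc_coeff :: "real \<Rightarrow> real \<Rightarrow> real \<Rightarrow> nat \<Rightarrow> real" where
  "acc_coeff s e z n = 1 / (1 + s) * (\<Prod>j<n. let X = s ^ j in
     - ((1 - s * X) * (1 - s^2 * X) * (1 - z * X) * (1 - s * X^2) * (1 - e * X^2) * (s^2 * z * X^3))
     / ((1 - z * X^2) * (1 - s^2 * z * X^2) * (1 - s^3 * X^3) * (1 - s^4 * X^3) * (1 - s^5 * X^3)))"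

definition acc_term :: "real \<Rightarrow> real \<Rightarrow> real \<Rightarrow> nat \<Rightarrow> real" where
  "acc_term s e z n = (let X = s ^ n in
     acc_coeff s e z n * (s * X^2 + (1 - s^2 * X^4) * (1 - s * z * X^3) / ((1 - s * X) * (1 - z * X^2))))"

text \<open>A well-poised term with a = s^2 X^4 and numerator parameters s X, s^2 X, s X^2, e X^2,
  argument q a^2 divided by their product, i.e. z X^2. The first two combine to base s and index 2k.
  The third, d = s X^2, satisfies d^2 = a: its quotient is (1 - d)/(1 - d y), which cancels one half
  of 1 - a y^2 = (1 - d y)(1 + d y) and leaves the factor 1 + d y of \<open>wz_F\<close>.\<close>

definition wz_weight :: "real \<Rightarrow> real \<Rightarrow> real \<Rightarrow> nat \<Rightarrow> nat \<Rightarrow> real" where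
  "wz_weight s e z n k = (let X = s ^ n in
     acc_coeff s e z n * ((1 - s^2 * X^3) / (1 - s * X))
     * (qpoch (s * X) s (2 * k) * qpoch (e * X^2) (s^2) k
        / (qpoch (s^2 * X^3) s (2 * k) * qpoch (s^2 * z * X^2) (s^2) k)) * (z * X^2) ^ k)"

definition wz_F :: "real \<Rightarrow> real \<Rightarrow> real \<Rightarrow> nat \<Rightarrow> nat \<Rightarrow> real" where
  "wz_F s e z n k = wz_weight s e z n k * (1 + s * (s ^ n)^2 * s ^ (2 * k))"

text \<open>
  The numerator of the certificate \<open>wz_G / wz_F\<close>, found by undetermined coefficients:
  it is quadratic in \<open>y = q ^ k\<close>, with \<open>X = s ^ n\<close>.
\<close>

definition wz_poly :: "real \<Rightarrow> real \<Rightarrow> real \<Rightarrow> real \<Rightarrow> real" where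
  "wz_poly s z X y =
     1 + s * X^2 * (1 - s * X - s * X^2 - z * X - z * X^2 + s * z * X^3) * y + s^3 * z * X^7 * y^2"

definition wz_G :: "real \<Rightarrow> real \<Rightarrow> real \<Rightarrow> nat \<Rightarrow> nat \<Rightarrow> real" where
  "wz_G s e z n k = (let X = s ^ n; y = s ^ (2 * k) in
     wz_weight s e z n k * wz_poly s z X y / ((1 - z * X^2) * (1 - s^2 * X^3 * y)))"

lemma wz_polynomial_identity:
  fixes s e z X y :: real
  assumes "e * z = s\<^sup>2"
  shows "(1 + s * X^2 * y) * (1 - z * X^2) * ((1 - s^2 * X^3 * y) * (1 - s^3 * X^3 * y) * (1 - s^4 * X^3 * y) * (1 - s^2 * z * X^2 * y))
       + s^2 * z * X^3 * (1 - s * X) * (1 - z * X) * (1 - s * X^2) * (1 + s^3 * X^2 * y) * (1 - s * X * y) * (1 - e * X^2 * y) * y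
       = wz_poly s z X y * ((1 - s^3 * X^3 * y) * (1 - s^4 * X^3 * y) * (1 - s^2 * z * X^2 * y))
         - z * X^2 * (1 - s * X * y) * (1 - s^2 * X * y) * (1 - e * X^2 * y) * wz_poly s z X (s^2 * y)"
proof -
  \<comment> \<open>The parameter e occurs only in 1 - e X^2 y, each time next to a factor z.
    Absorbing this z eliminates e and leaves an unconditional identity in s, z, X, y, settled by
    expansion.\<close>
  have ze: "z * (1 - e * X^2 * y) = z - s^2 * X^2 * y"
    using assms by (simp add: algebra_simps)
  have 1: "s^2 * z * X^3 * (1 - s * X) * (1 - z * X) * (1 - s * X^2) * (1 + s^3 * X^2 * y) * (1 - s * X * y) * (1 - e * X^2 * y) * y
      = s^2 * X^3 * (1 - s * X) * (1 - z * X) * (1 - s * X^2) * (1 + s^3 * X^2 * y) * (1 - s * X * y) * (z - s^2 * X^2 * y) * y"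
    unfolding ze[symmetric] by (simp add: mult_ac)
  have 2: "z * X^2 * (1 - s * X * y) * (1 - s^2 * X * y) * (1 - e * X^2 * y) * wz_poly s z X (s^2 * y)
      = X^2 * (1 - s * X * y) * (1 - s^2 * X * y) * (z - s^2 * X^2 * y) * wz_poly s z X (s^2 * y)"
    unfolding ze[symmetric] by (simp add: mult_ac)
  show ?thesis unfolding 1 2 unfolding wz_poly_def by (simp add: algebra_simps eval_nat_numeral)
qed

text \<open>At k = 0, where y = 1, the numerator of the certificate becomes the numerator of the
  expression in braces in the theorem.\<close>

lemma acc_term_polynomial_identity:
  fixes s z X :: real
  shows "wz_poly s z X 1 = s * X^2 * ((1 - s * X) * (1 - z * X^2)) + (1 - s^2 * X^4) * (1 - s * z * X^3)"
  unfolding wz_poly_def by (simp add: algebra_simps eval_nat_numeral)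

context
  fixes s e z :: real
  assumes s: "0 < s" "s < 1" and e: "0 < e" "e < 1" and z: "0 < z" "z < 1" and ez: "e * z = s\<^sup>2"
begin

lemma acc_coeff_Suc:
  "acc_coeff s e z (Suc n) = acc_coeff s e z n *
     (- ((1 - s * s ^ n) * (1 - s^2 * s ^ n) * (1 - z * s ^ n) * (1 - s * (s ^ n)^2) * (1 - e * (s ^ n)^2) * (s^2 * z * (s ^ n)^3))
     / ((1 - z * (s ^ n)^2) * (1 - s^2 * z * (s ^ n)^2) * (1 - s^3 * (s ^ n)^3) * (1 - s^4 * (s ^ n)^3) * (1 - s^5 * (s ^ n)^3)))"
  by (simp add: acc_coeff_def Let_def)

lemma wz_factors_less_1:
  fixes X y :: real
  assumes X: "0 < X" "X \<le> 1" and y: "0 < y" "y \<le> 1"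
  shows "s ^ Suc i * X ^ j * y < 1" "z * X ^ j * y < 1" "s^2 * z * X ^ j * y < 1" "e * X ^ j * y < 1"
proof -
  have "a * X ^ j * y < 1" if "0 < a" "a < 1" for a
  proof -
    have "a * (X ^ j * y) \<le> a * 1"
      using that X y by (intro mult_left_mono mult_le_one power_le_one) auto
    hence "a * (X ^ j * y) < 1" using that by linarith
    thus ?thesis by (simp only: mult.assoc)
  qed
  note * = this
  show "s ^ Suc i * X ^ j * y < 1" using s by (intro *) (auto simp: power_Suc_less_one simp del: power_Suc)
  show "z * X ^ j * y < 1" "e * X ^ j * y < 1" using z e by (auto intro!: *)
  have "s^2 * z < 1" using s z mult_strict_mono[of "s^2" 1 z 1] by (simp add: power_less_one_iff)
  thus "s^2 * z * X ^ j * y < 1" using s z by (intro *) auto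
qed

lemma wz_weight_Suc_right:
  fixes n k :: nat
  defines "X \<equiv> s ^ n" and "y \<equiv> s ^ (2 * k)"
  shows "wz_weight s e z n (Suc k) = wz_weight s e z n k *
     ((1 - s * X * y) * (1 - s^2 * X * y) * (1 - e * X^2 * y)
      / ((1 - s^2 * X^3 * y) * (1 - s^3 * X^3 * y) * (1 - s^2 * z * X^2 * y)) * (z * X^2))"
proof -
  have y2: "(s^2) ^ k = y" by (simp add: y_def power_mult)
  have q2: "qpoch x s (2 * Suc k) = qpoch x s (2 * k) * ((1 - y * x) * (1 - s * y * x))" for x
    by (simp add: qpoch_Suc y_def)
  show ?thesis
    unfolding wz_weight_def Let_def X_def[symmetric] q2 qpoch_Suc y2
    by (simp add: eval_nat_numeral mult_ac)
qed

text \<open>Passing to n + 1 replaces X by s X. Each shifted factorial then moves by whole places of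
  its base, and the resulting factors free of y cancel in part against
  \<open>acc_coeff_Suc\<close>.\<close>

lemma wz_weight_Suc_left:
  fixes n k :: nat
  defines "X \<equiv> s ^ n" and "y \<equiv> s ^ (2 * k)"
  shows "wz_weight s e z (Suc n) k = wz_weight s e z n k *
     (- (s^2 * z * X^3 * (1 - s * X) * (1 - z * X) * (1 - s * X^2) * (1 - s * X * y) * (1 - e * X^2 * y) * y)
      / ((1 - z * X^2) * ((1 - s^2 * X^3 * y) * (1 - s^3 * X^3 * y) * (1 - s^4 * X^3 * y) * (1 - s^2 * z * X^2 * y))))"
proof -
  have X: "0 < X" "X \<le> 1" and y: "0 < y" "y \<le> 1"
    using s by (auto simp: X_def y_def power_le_one)
  have y2: "(s^2) ^ k = y" by (simp add: y_def power_mult)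
  have sh: "qpoch (p * x) p m = qpoch x p m * (1 - p ^ m * x) / (1 - x)" if "x < 1" for p x m
    using qpoch_shift[of x p m] that by (simp add: field_simps)
  note lt = wz_factors_less_1[OF X y] wz_factors_less_1[OF X, of 1, simplified]
  have lt1: "s * X < 1" "s^2 * X < 1" "e * X^2 < 1" "s^2 * X^3 < 1" "s^3 * X^3 < 1" "s^4 * X^3 < 1" "s^5 * X^3 < 1"
    "s^2 * z * X^2 < 1" "z * X^2 < 1"
    using lt(5)[of 0 1] lt(5)[of 1 1] lt(5)[of 1 3] lt(5)[of 2 3] lt(5)[of 3 3] lt(5)[of 4 3] lt(6)[of 2] lt(7)[of 2] lt(8)[of 2]
    by (simp_all add: eval_nat_numeral mult_ac)
  have p1: "qpoch (s * (s * X)) s (2 * k) = qpoch (s * X) s (2 * k) * (1 - s * X * y) / (1 - s * X)"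
    using sh[OF lt1(1), of s "2 * k"] by (simp add: y_def mult_ac)
  have p2: "qpoch (e * (s * X)^2) (s^2) k = qpoch (e * X^2) (s^2) k * (1 - e * X^2 * y) / (1 - e * X^2)"
    using sh[OF lt1(3), of "s^2" k] by (simp add: y2 power_mult_distrib mult_ac)
  have p3: "qpoch (s^2 * z * (s * X)^2) (s^2) k = qpoch (s^2 * z * X^2) (s^2) k * (1 - s^2 * z * X^2 * y) / (1 - s^2 * z * X^2)"
    using sh[OF lt1(8), of "s^2" k] by (simp add: y2 power_mult_distrib mult_ac)
  \<comment> \<open>Here X^3 turns into s^3 X^3, a shift by three places in base s.\<close>
  have p4: "qpoch (s^2 * (s * X)^3) s (2 * k) = qpoch (s^2 * X^3) s (2 * k)
      * ((1 - s^2 * X^3 * y) * (1 - s^3 * X^3 * y) * (1 - s^4 * X^3 * y)) / ((1 - s^2 * X^3) * (1 - s^3 * X^3) * (1 - s^4 * X^3))"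
  proof -
    have sh': "qpoch (s * x) s (2 * k) = qpoch x s (2 * k) * (1 - y * x) / (1 - x)" if "x < 1" for x
      using sh[OF that, of s "2 * k"] by (simp add: y_def)
    have eqs: "s * (s^4 * X^3) = s^2 * (s * X)^3" "s * (s^3 * X^3) = s^4 * X^3" "s * (s^2 * X^3) = s^3 * X^3"
      by (simp_all add: eval_nat_numeral mult_ac)
    show ?thesis
      unfolding sh'[OF lt1(6), unfolded eqs] sh'[OF lt1(5), unfolded eqs] sh'[OF lt1(4), unfolded eqs]
      by (simp add: mult_ac)
  qed
  have p5: "(z * (s * X)^2) ^ k = (z * X^2) ^ k * y"
    by (simp add: power_mult_distrib y2 mult_ac)
  have p6: "(1 - s^2 * (s * X)^3) / (1 - s * (s * X)) = (1 - s^5 * X^3) / (1 - s^2 * X)"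
    by (simp add: eval_nat_numeral mult_ac)
  have W: "wz_weight s e z (Suc n) k = acc_coeff s e z (Suc n) * ((1 - s^5 * X^3) / (1 - s^2 * X))
     * (qpoch (s * (s * X)) s (2 * k) * qpoch (e * (s * X)^2) (s^2) k
        / (qpoch (s^2 * (s * X)^3) s (2 * k) * qpoch (s^2 * z * (s * X)^2) (s^2) k)) * (z * (s * X)^2) ^ k"
    unfolding wz_weight_def Let_def power_Suc X_def[symmetric] p6 by simp
  \<comment> \<open>The cancellation is stated for abstract factors, so that no polynomial is
    multiplied out.\<close>
  have A: "a1 * (- (a * b * f2 * f3 * f4 * m) / (g1 * g2 * g3 * g4 * g5)) * (g5 / b)
       * ((Q1 * u1 / a) * (Q2 * u2 / f4) / ((Q3 * (v2 * v3 * v4) / (g0 * g3 * g4)) * (Q4 * v5 / g2))) * (Z * y)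
     = a1 * (g0 / a) * (Q1 * Q2 / (Q3 * Q4)) * Z * (- (m * a * f2 * f3 * u1 * u2 * y) / (g1 * (v2 * v3 * v4 * v5)))"
    if "a \<noteq> 0" "b \<noteq> 0" "f4 \<noteq> 0" "g0 \<noteq> 0" "g2 \<noteq> 0" "g3 \<noteq> 0" "g4 \<noteq> 0" "g5 \<noteq> 0"
    for a1 a b f2 f3 f4 m g0 g1 g2 g3 g4 g5 Q1 Q2 Q3 Q4 u1 u2 v2 v3 v4 v5 Z :: real
    using that by (simp add: mult_ac)
  show ?thesis
    unfolding W p1 p2 p3 p4 p5 acc_coeff_Suc X_def[symmetric]
    by (subst A) (use lt1 in \<open>simp_all add: wz_weight_def Let_def X_def[symmetric]\<close>)
qed

text \<open>Both sides are \<open>W / D\<close> times the two sides of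
  \<open>wz_polynomial_identity\<close>.\<close>

lemma wz_pair:
  "wz_F s e z n k - wz_F s e z (Suc n) k = wz_G s e z n k - wz_G s e z n (Suc k)"
proof -
  define X where "X = s ^ n"
  define y where "y = s ^ (2 * k)"
  define W where "W = wz_weight s e z n k"
  define N where "N = (1 - s^2 * X^3 * y) * (1 - s^3 * X^3 * y) * (1 - s^4 * X^3 * y) * (1 - s^2 * z * X^2 * y)"
  define D where "D = (1 - z * X^2) * N"
  have X: "0 < X" "X \<le> 1" and y: "0 < y" "y \<le> 1"
    using s by (auto simp: X_def y_def power_le_one)
  have "z * X^2 < 1" using wz_factors_less_1(2)[OF X, of 1 2] by simp
  moreover have lt: "s^2 * X^3 * y < 1" "s^3 * X^3 * y < 1" "s^4 * X^3 * y < 1" "s^2 * z * X^2 * y < 1"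
    using wz_factors_less_1(1)[OF X y, of 1 3] wz_factors_less_1(1)[OF X y, of 2 3]
      wz_factors_less_1(1)[OF X y, of 3 3] wz_factors_less_1(3)[OF X y, of 2]
    by (simp_all add: eval_nat_numeral mult_ac)
  ultimately have D: "1 - z * X^2 \<noteq> 0" "N \<noteq> 0" by (auto simp: N_def)
  have 1: "wz_F s e z n k = W * ((1 + s * X^2 * y) * (1 - z * X^2) * N) / D"
    using D by (simp add: wz_F_def W_def X_def y_def D_def)
  have yS: "s ^ (2 * Suc k) = s^2 * y" by (simp add: y_def power2_eq_square)
  have "wz_F s e z (Suc n) k = wz_weight s e z (Suc n) k * (1 + s^3 * X^2 * y)"
    by (simp add: wz_F_def X_def y_def eval_nat_numeral mult_ac)
  also have "\<dots> = - W * (s^2 * z * X^3 * (1 - s * X) * (1 - z * X) * (1 - s * X^2) * (1 + s^3 * X^2 * y) * (1 - s * X * y) * (1 - e * X^2 * y) * y) / D"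
    unfolding wz_weight_Suc_left X_def[symmetric] y_def[symmetric] W_def[symmetric] N_def[symmetric] D_def[symmetric]
    by (simp add: mult_ac)
  finally have 2: "wz_F s e z (Suc n) k = \<dots>" .
  have 3: "wz_G s e z n k = W * (wz_poly s z X y * ((1 - s^3 * X^3 * y) * (1 - s^4 * X^3 * y) * (1 - s^2 * z * X^2 * y))) / D"
    using lt unfolding wz_G_def Let_def W_def[symmetric] X_def[symmetric] y_def[symmetric] D_def N_def
    by (simp add: mult_ac)
  have s4: "s^2 * X^3 * (s^2 * y) = s^4 * X^3 * y" by (simp add: eval_nat_numeral mult_ac)
  have 4: "wz_G s e z n (Suc k) = W * (z * X^2 * (1 - s * X * y) * (1 - s^2 * X * y) * (1 - e * X^2 * y) * wz_poly s z X (s^2 * y)) / D"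
    using lt unfolding wz_G_def Let_def X_def[symmetric] yS s4 wz_weight_Suc_right y_def[symmetric] W_def[symmetric] D_def N_def
    by (simp add: mult_ac)
  have "wz_F s e z n k - wz_F s e z (Suc n) k = W * ((1 + s * X^2 * y) * (1 - z * X^2) * N +
     s^2 * z * X^3 * (1 - s * X) * (1 - z * X) * (1 - s * X^2) * (1 + s^3 * X^2 * y) * (1 - s * X * y) * (1 - e * X^2 * y) * y) / D"
    unfolding 1 2 by (simp add: add_divide_distrib ring_distribs(1))
  also have "\<dots> = wz_G s e z n k - wz_G s e z n (Suc k)"
    unfolding N_def wz_polynomial_identity[OF ez] 3 4 by (simp add: diff_divide_distrib right_diff_distrib)
  finally show ?thesis .
qed

lemma wz_G_0: "wz_G s e z n 0 = acc_term s e z n"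
proof -
  define X where "X = s ^ n"
  have X: "0 < X" "X \<le> 1"
    using s by (auto simp: X_def power_le_one)
  have lt: "z * X^2 < 1" "s * X < 1" "s^2 * X^3 < 1"
    using wz_factors_less_1(2)[OF X, of 1 2] wz_factors_less_1(1)[OF X, of 1 0 1] wz_factors_less_1(1)[OF X, of 1 1 3]
    by (simp_all add: power2_eq_square)
  have "wz_G s e z n 0 = acc_coeff s e z n * (wz_poly s z X 1 / ((1 - s * X) * (1 - z * X^2)))"
    using lt by (simp add: wz_G_def wz_weight_def Let_def X_def[symmetric])
  also have "wz_poly s z X 1 / ((1 - s * X) * (1 - z * X^2)) =
      s * X^2 + (1 - s^2 * X^4) * (1 - s * z * X^3) / ((1 - s * X) * (1 - z * X^2))"
    unfolding acc_term_polynomial_identity add_divide_distrib using lt by simp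
  finally show ?thesis by (simp add: acc_term_def Let_def X_def)
qed

end

section \<open>Summation of the accelerated series\<close>

context
  fixes s e z :: real
  assumes s: "0 < s" "s < 1" and e: "0 < e" "e < 1" and z: "0 < z" "z \<le> s" "s ^ 5 \<le> z" and ez: "e * z = s\<^sup>2"
begin

lemma z_less_1: "z < 1"
  using s z by linarith

lemma s2z_le: "s\<^sup>2 * z \<le> z" "s\<^sup>2 * z \<le> e"
proof -
  show "s\<^sup>2 * z \<le> z" using s z by (simp add: mult_left_le_one_le power_le_one)
  have "s\<^sup>2 * z = e * (z * z)" using ez by simp
  also have "\<dots> \<le> e" using e z z_less_1 by (simp add: mult_le_one)
  finally show "s\<^sup>2 * z \<le> e" .
qed

text \<open>In the ratio of consecutive coefficients each factor 1 - u of the numerator is paired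
  with a factor 1 - v of the denominator such that v <= u, so no quotient blows up as s -> 1. The
  inequalities z <= s and s^5 <= z make this pairing possible.\<close>

lemma acc_coeff_bound: "\<bar>acc_coeff s e z n\<bar> \<le> (1 / 3) ^ n"
proof (induction n)
  case 0
  show ?case using s by (simp add: acc_coeff_def)
next
  case (Suc n)
  define X where "X = s ^ n"
  have X: "0 < X" "X \<le> 1" using s by (auto simp: X_def power_le_one)
  have X2: "X^3 \<le> X" "X^3 \<le> X^2" "X^3 \<le> 1"
    using X power_decreasing[of 1 3 X] power_decreasing[of 2 3 X] by (auto simp: power_le_one)
  have quot: "\<bar>(1 - u) / (1 - v)\<bar> \<le> 1" if "v \<le> u" "u < 1" for u v :: real
    using that by (simp add: abs_le_iff divide_le_eq)
  note lt = wz_factors_less_1[OF s e z(1) z_less_1 ez X, of 1, simplified]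
  have l: "s * X < 1" "s^2 * X < 1" "z * X < 1" "s * X^2 < 1" "e * X^2 < 1"
    using lt(1)[of 0 1] lt(1)[of 1 1] lt(1)[of 0 2] lt(2)[of 1] lt(4)[of 2] by (simp_all add: power2_eq_square)
  have "s^4 \<le> s^2" using s by (intro power_decreasing) auto
  hence q1: "\<bar>(1 - s^2 * X) / (1 - s^4 * X^3)\<bar> \<le> 1"
    using s X X2 l by (intro quot mult_mono) auto
  have q2: "\<bar>(1 - z * X) / (1 - s^5 * X^3)\<bar> \<le> 1"
    using s z X X2 l by (intro quot mult_mono) auto
  have q3: "\<bar>(1 - s * X^2) / (1 - z * X^2)\<bar> \<le> 1"
    using s z X X2 l by (intro quot mult_mono) auto
  have q4: "\<bar>(1 - e * X^2) / (1 - s^2 * z * X^2)\<bar> \<le> 1"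
    using e X l s2z_le by (intro quot mult_mono) auto
  \<comment> \<open>With u = s X the quotient is at most u^3 (1 - u) / (1 - u^3) = u^3 / (1 + u +
    u^2), hence at most 1/3, uniformly in s.\<close>
  have q5: "\<bar>(1 - s * X) * (s^2 * z * X^3) / (1 - s^3 * X^3)\<bar> \<le> 1 / 3"
  proof -
    define u where "u = s * X"
    have u: "0 < u" "u < 1" using s X l by (auto simp: u_def)
    have u3: "u ^ 3 < 1" "u ^ 3 \<le> u" "u ^ 3 \<le> u^2" using u power_decreasing[of 1 3 u] power_decreasing[of 2 3 u]
      by (auto simp: power_less_one_iff)
    have "s^2 * z * X^3 \<le> s^2 * s * X^3" using s z X by (intro mult_mono) auto
    also have "\<dots> = u ^ 3" by (simp add: u_def eval_nat_numeral)
    finally have m: "s^2 * z * X^3 \<le> u ^ 3" .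
    have "(1 - u) * (s^2 * z * X^3) \<le> (1 - u) * u ^ 3" using u m by (intro mult_left_mono) auto
    moreover have "0 \<le> 1 + u + u^2 - 3 * u^3" using u3 by linarith
    hence "0 \<le> (1 - u) * (1 + u + u^2 - 3 * u^3)" using u by (intro mult_nonneg_nonneg) auto
    hence "3 * ((1 - u) * u ^ 3) \<le> 1 - u ^ 3" by (simp add: algebra_simps eval_nat_numeral)
    ultimately have "(1 - u) * (s^2 * z * X^3) / (1 - u ^ 3) \<le> 1 / 3" using u3 by (simp add: field_simps)
    moreover have "0 \<le> (1 - u) * (s^2 * z * X^3) / (1 - u ^ 3)"
      using u u3 s z X by (intro divide_nonneg_nonneg mult_nonneg_nonneg) auto
    ultimately have "\<bar>(1 - u) * (s^2 * z * X^3) / (1 - u ^ 3)\<bar> \<le> 1 / 3" by linarith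
    thus ?thesis unfolding u_def power_mult_distrib .
  qed
  have "acc_coeff s e z (Suc n) = - acc_coeff s e z n * (((1 - s^2 * X) / (1 - s^4 * X^3)) * ((1 - z * X) / (1 - s^5 * X^3))
      * ((1 - s * X^2) / (1 - z * X^2)) * ((1 - e * X^2) / (1 - s^2 * z * X^2))
      * ((1 - s * X) * (s^2 * z * X^3) / (1 - s^3 * X^3)))"
    unfolding acc_coeff_Suc[OF s e z(1) z_less_1 ez] X_def[symmetric] by (simp add: mult_ac)
  also have "\<bar>\<dots>\<bar> \<le> (1 / 3) ^ n * (1 * 1 * 1 * 1 * (1 / 3))"
    unfolding abs_mult abs_minus by (intro mult_mono Suc.IH q1 q2 q3 q4 q5) auto
  finally show ?case by simp
qed

text \<open>Each numerator parameter dominates its partner below, s X >= s^2 X^3 and e X^2 >= s^2 z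
  X^2, so both quotients of shifted factorials are at most 1. What remains is geometric in n and in
  k.\<close>

lemma wz_weight_bound: "\<bar>wz_weight s e z n k\<bar> \<le> (1 / 3) ^ n * (1 / (1 - s)) * z ^ k"
proof -
  define X where "X = s ^ n"
  have X: "0 < X" "X \<le> 1" using s by (auto simp: X_def power_le_one)
  have X2: "X^2 \<le> 1" "X^3 \<le> X" using X power_decreasing[of 1 3 X] by (auto simp: power_le_one)
  note lt = wz_factors_less_1[OF s e z(1) z_less_1 ez X, of 1, simplified]
  have l: "s * X < 1" "s^2 * X^3 < 1" "e * X^2 < 1" "s^2 * z * X^2 < 1"
    using lt(1)[of 0 1] lt(1)[of 1 3] lt(3,4)[of 2] by (simp_all add: power2_eq_square)
  have sX: "s * X \<le> s" using s X by (simp add: mult_left_le)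
  have b1: "\<bar>(1 - s^2 * X^3) / (1 - s * X)\<bar> \<le> 1 / (1 - s)"
  proof -
    have "1 - s \<le> \<bar>1 - s * X\<bar>" "\<bar>1 - s^2 * X^3\<bar> \<le> 1" using sX l s X by (linarith, simp add: abs_le_iff)
    thus ?thesis unfolding abs_divide using s by (intro frac_le) auto
  qed
  have ratio: "\<bar>qpoch u p m / qpoch v p m\<bar> \<le> 1" if "0 \<le> p" "p \<le> 1" "0 \<le> v" "v \<le> u" "u < 1" for u v p m
    using qpoch_antimono[of p v u m] qpoch_pos[of p v m] qpoch_nonneg[of p u m] that by (simp add: abs_le_iff)
  have b2: "\<bar>qpoch (s * X) s (2 * k) / qpoch (s^2 * X^3) s (2 * k)\<bar> \<le> 1"
    using s X l X2 by (intro ratio mult_mono) (auto simp: power2_eq_square mult_left_le)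
  have b3: "\<bar>qpoch (e * X^2) (s^2) k / qpoch (s^2 * z * X^2) (s^2) k\<bar> \<le> 1"
    using s z e X l s2z_le by (intro ratio mult_mono) (auto simp: power_le_one)
  have b4: "\<bar>(z * X^2) ^ k\<bar> \<le> z ^ k"
    using z X X2
    by (subst abs_of_nonneg) (auto intro!: power_mono simp: mult_left_le)
  have "wz_weight s e z n k = acc_coeff s e z n * ((1 - s^2 * X^3) / (1 - s * X))
     * ((qpoch (s * X) s (2 * k) / qpoch (s^2 * X^3) s (2 * k)) * (qpoch (e * X^2) (s^2) k / qpoch (s^2 * z * X^2) (s^2) k))
     * (z * X^2) ^ k"
    by (simp add: wz_weight_def Let_def X_def)
  also have "\<bar>\<dots>\<bar> \<le> (1 / 3) ^ n * (1 / (1 - s)) * (1 * 1) * z ^ k"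
    unfolding abs_mult using s by (intro mult_mono acc_coeff_bound b1 b2 b3 b4) auto
  finally show ?thesis by simp
qed

lemma wz_F_bound: "\<bar>wz_F s e z n k\<bar> \<le> (1 / 3) ^ n * (2 / (1 - s) * z ^ k)"
proof -
  have "s * (s ^ n)^2 * s ^ (2 * k) \<le> 1"
    using s by (intro mult_le_one power_le_one) auto
  hence "\<bar>1 + s * (s ^ n)^2 * s ^ (2 * k)\<bar> \<le> 2" using s by simp
  hence "\<bar>wz_F s e z n k\<bar> \<le> ((1 / 3) ^ n * (1 / (1 - s)) * z ^ k) * 2"
    unfolding wz_F_def abs_mult using s z by (intro mult_mono wz_weight_bound) auto
  thus ?thesis by (simp add: mult_ac)
qed

lemma wz_F_summable: "summable (wz_F s e z n)"
proof (rule summable_comparison_test'[of "\<lambda>k. (1 / 3) ^ n * (2 / (1 - s) * z ^ k)" 0])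
  show "summable (\<lambda>k. (1 / 3) ^ n * (2 / (1 - s) * z ^ k))"
    using z z_less_1 by (intro summable_mult summable_geometric) auto
qed (use wz_F_bound in auto)

lemma wz_G_tendsto_0: "wz_G s e z n \<longlonglongrightarrow> 0"
proof -
  define X where "X = s ^ n"
  have X: "0 < X" "X \<le> 1" using s by (auto simp: X_def power_le_one)
  have zX: "z * X^2 < 1" using wz_factors_less_1(2)[OF s e z(1) z_less_1 ez X, of 1 2] by simp
  have W: "wz_weight s e z n \<longlonglongrightarrow> 0"
  proof (rule Lim_null_comparison)
    show "(\<lambda>k. (1 / 3) ^ n * (1 / (1 - s)) * z ^ k) \<longlonglongrightarrow> 0"
      using z z_less_1 by (intro tendsto_mult_right_zero LIMSEQ_power_zero) auto
  qed (use wz_weight_bound in auto)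
  have y: "(\<lambda>k. s ^ (2 * k)) \<longlonglongrightarrow> 0"
    unfolding power_mult using s by (intro LIMSEQ_power_zero) (simp add: power_less_one_iff)
  have "(\<lambda>k. wz_weight s e z n k * wz_poly s z X (s ^ (2 * k)) / ((1 - z * X^2) * (1 - s^2 * X^3 * s ^ (2 * k))))
      \<longlonglongrightarrow> 0 * wz_poly s z X 0 / ((1 - z * X^2) * (1 - s^2 * X^3 * 0))"
    unfolding wz_poly_def using zX by (intro tendsto_intros W y) auto
  thus ?thesis by (simp add: wz_G_def[abs_def] Let_def X_def)
qed

text \<open>For a = q and b = c = s all shifted factorials except those of e and s^2 z collapse:
  (s;s)_2k / (s^2;s)_2k and (s;q)_k / (s^3;q)_k both equal (1 - s)/(1 - s y). The constant is (1 +
  s)(1 - s)^2 / (1 - s^2) = 1 - s.\<close>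

lemma wz_F_0: "wz_F s e z 0 = (\<lambda>k. (1 + s) * phi65_term (s\<^sup>2) (s\<^sup>2) s s e z k)"
proof
  fix k
  define y where "y = s ^ (2 * k)"
  have y: "0 < y" "y \<le> 1" using s by (auto simp: y_def power_le_one)
  have s2: "s^2 < 1" "s^3 < 1" using s by (auto simp: power_less_one_iff)
  have y2: "(s^2) ^ k = y" by (simp add: y_def power_mult)
  have sy: "s * y < 1" using mult_left_le[of y s] s y by linarith
  have sh: "qpoch x p m = (1 - x) * qpoch (p * x) p m / (1 - p ^ m * x)" if "p ^ m * x < 1" for p x m
    using qpoch_shift[of x p m] that by (simp add: field_simps)
  have p1: "qpoch s s (2 * k) = (1 - s) * qpoch (s^2) s (2 * k) / (1 - s * y)"
    using sh[of s "2 * k" s] sy by (simp add: y_def power2_eq_square mult_ac)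
  have p2: "qpoch s (s^2) k = (1 - s) * qpoch (s^3) (s^2) k / (1 - s * y)"
  proof -
    have "s^2 * s = s^3" by (simp add: power3_eq_cube power2_eq_square)
    from sh[of "s^2" k s, unfolded y2 this] show ?thesis using sy by (simp add: mult_ac)
  qed
  have ze: "z * s * e = s^3" using ez by (simp add: power3_eq_cube power2_eq_square mult_ac)
  have nz: "qpoch (s^2) s (2 * k) \<noteq> 0" "qpoch (s^3) (s^2) k \<noteq> 0" "qpoch (s^2) (s^2) k \<noteq> 0"
    using s s2 by (auto intro!: less_imp_neq[symmetric] qpoch_pos simp: less_imp_le)
  have "wz_F s e z 0 k = (1 - s^2) / ((1 + s) * (1 - s)) * ((1 - s) / (1 - s * y)) * (qpoch e (s^2) k / qpoch (s^2 * z) (s^2) k) * z ^ k * (1 + s * y)"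
  proof -
    define Q where "Q = qpoch (s^2) s (2 * k)"
    have "wz_weight s e z 0 k = 1 / (1 + s) * ((1 - s^2) / (1 - s)) * (qpoch s s (2 * k) * qpoch e (s^2) k / (Q * qpoch (s^2 * z) (s^2) k)) * z ^ k"
      by (simp add: wz_weight_def Let_def acc_coeff_def Q_def)
    moreover have "s * (s ^ 0)^2 * s ^ (2 * k) = s * y" by (simp add: y_def)
    ultimately show ?thesis
      using nz(1) unfolding wz_F_def p1 Q_def[symmetric] by simp
  qed
  also have "(1 - s^2) / ((1 + s) * (1 - s)) = 1"
  proof -
    have "1 - s^2 = (1 + s) * (1 - s)" by (simp add: power2_eq_square algebra_simps)
    thus ?thesis using s by simp
  qed
  finally have 1: "wz_F s e z 0 k = (1 - s) * (1 + s * y) / (1 - s * y) * (qpoch e (s^2) k / qpoch (s^2 * z) (s^2) k) * z ^ k"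
    by simp
  have "(1 + s) * phi65_term (s^2) (s^2) s s e z k =
     (1 + s) * (1 - s)^2 / (1 - s^2) * ((1 - s^2 * y^2) / (1 - s * y)^2) * (qpoch e (s^2) k / qpoch (s^2 * z) (s^2) k) * z ^ k"
    using nz unfolding phi65_term_def phi65_coeff_def y2 ze p2 by (simp add: power2_eq_square mult_ac)
  also have "(1 + s) * (1 - s)^2 / (1 - s^2) = 1 - s"
  proof -
    have "1 - s^2 = (1 + s) * (1 - s)" by (simp add: power2_eq_square algebra_simps)
    thus ?thesis using s by (simp add: power2_eq_square)
  qed
  also have "(1 - s^2 * y^2) / (1 - s * y)^2 = (1 + s * y) / (1 - s * y)"
  proof -
    have "1 - s^2 * y^2 = (1 + s * y) * (1 - s * y)" by (simp add: algebra_simps power2_eq_square)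
    thus ?thesis using sy by (simp add: power2_eq_square)
  qed
  finally show "wz_F s e z 0 k = (1 + s) * phi65_term (s^2) (s^2) s s e z k"
    unfolding 1 by simp
qed

theorem acc_term_sums:
  "acc_term s e z sums
     ((qpoch_inf (s\<^sup>2) (s\<^sup>2))\<^sup>2 * (qpoch_inf (s * z) (s\<^sup>2))\<^sup>2
      / (qpoch_inf s (s\<^sup>2) * qpoch_inf (s ^ 3) (s\<^sup>2) * qpoch_inf z (s\<^sup>2) * qpoch_inf (s\<^sup>2 * z) (s\<^sup>2)))"
    (is "_ sums ?P")
proof -
  define S where "S = (\<lambda>n. suminf (wz_F s e z n))"
  have S_step: "S n - S (Suc n) = acc_term s e z n" for n
  proof -
    have "(\<lambda>k. wz_F s e z n k - wz_F s e z (Suc n) k) sums acc_term s e z n"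
      unfolding wz_pair[OF s e z(1) z_less_1 ez]
      using telescope_sums'[OF wz_G_tendsto_0, of n] by (simp add: wz_G_0[OF s e z(1) z_less_1 ez])
    moreover have "(\<lambda>k. wz_F s e z n k - wz_F s e z (Suc n) k) sums (S n - S (Suc n))"
      unfolding S_def by (intro sums_diff summable_sums wz_F_summable)
    ultimately show ?thesis using sums_unique2 by blast
  qed
  have geo: "summable (\<lambda>k. 2 / (1 - s) * z ^ k)"
    using z z_less_1 by (intro summable_mult summable_geometric) auto
  have "S \<longlonglongrightarrow> 0"
  proof (rule Lim_null_comparison)
    have "\<bar>S n\<bar> \<le> (1 / 3) ^ n * (\<Sum>k. 2 / (1 - s) * z ^ k)" for n
    proof -
      have "norm (S n) \<le> (\<Sum>k. (1 / 3) ^ n * (2 / (1 - s) * z ^ k))"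
        unfolding S_def using wz_F_bound by (intro norm_suminf_le summable_mult geo) auto
      also have "\<dots> = (1 / 3) ^ n * (\<Sum>k. 2 / (1 - s) * z ^ k)"
        by (intro suminf_mult geo)
      finally show ?thesis by simp
    qed
    thus "\<forall>\<^sub>F n in sequentially. norm (S n) \<le> (1 / 3) ^ n * (\<Sum>k. 2 / (1 - s) * z ^ k)"
      by simp
    show "(\<lambda>n. (1 / 3) ^ n * (\<Sum>k. 2 / (1 - s) * z ^ k)) \<longlonglongrightarrow> 0"
      by (intro tendsto_mult_left_zero LIMSEQ_power_zero) simp
  qed
  from telescope_sums'[OF this] have "acc_term s e z sums S 0"
    by (simp add: S_step)
  moreover have "S 0 = ?P"
  proof -
    have s2: "0 < s^2" "s^2 < 1" using s by (auto simp: power_less_one_iff)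
    have ze: "z * s * e = s^3" "z * e = s^2" "z * s * s = s^2 * z" "z * s = s * z" "s^2 * s = s^3"
      using ez by (simp_all add: power3_eq_cube power2_eq_square mult_ac)
    have "s^2 * s^2 = z * s * s * e" using ez by (simp add: power2_eq_square mult_ac)
    note phi = phi65_sums[OF s2 s2 s s e z(1) z_less_1 this, unfolded ze(1-3), unfolded ze(4)]
    have "S 0 = (1 + s) * (qpoch_inf (s^2 * s^2) (s^2) * qpoch_inf (s * z) (s^2) * qpoch_inf (s * z) (s^2) * qpoch_inf (s^2) (s^2)
        / (qpoch_inf (s^3) (s^2) * qpoch_inf (s^3) (s^2) * qpoch_inf (s^2 * z) (s^2) * qpoch_inf z (s^2)))"
      unfolding S_def wz_F_0 by (intro sums_unique[symmetric] sums_mult phi)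
    \<comment> \<open>Pulling 1 - q out of (q^2;q) leaves (1 + s)/(1 - s^2) = 1/(1 - s), which turns
      one of the two products (s^3;q) below into (s;q). This explains the unequal pair q^(1/2),
      q^(3/2) in the theorem.\<close>
    also have "qpoch_inf (s^2 * s^2) (s^2) = qpoch_inf (s^2) (s^2) / (1 - s^2)"
      using qpoch_inf_rec[of "s^2" "s^2"] s2 by (simp add: field_simps)
    also have "(1 + s) * (qpoch_inf (s^2) (s^2) / (1 - s^2) * qpoch_inf (s * z) (s^2) * qpoch_inf (s * z) (s^2) * qpoch_inf (s^2) (s^2)
        / (qpoch_inf (s^3) (s^2) * qpoch_inf (s^3) (s^2) * qpoch_inf (s^2 * z) (s^2) * qpoch_inf z (s^2)))
        = (1 + s) / (1 - s^2) * (qpoch_inf (s^2) (s^2) * qpoch_inf (s * z) (s^2) * qpoch_inf (s * z) (s^2) * qpoch_inf (s^2) (s^2)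
        / (qpoch_inf (s^3) (s^2) * qpoch_inf (s^3) (s^2) * qpoch_inf (s^2 * z) (s^2) * qpoch_inf z (s^2)))"
      by (simp add: mult_ac)
    also have "(1 + s) / (1 - s^2) = 1 / (1 - s)"
      using s s2 by (simp add: power2_eq_square field_simps)
    also have "1 / (1 - s) * (qpoch_inf (s^2) (s^2) * qpoch_inf (s * z) (s^2) * qpoch_inf (s * z) (s^2) * qpoch_inf (s^2) (s^2)
        / (qpoch_inf (s^3) (s^2) * qpoch_inf (s^3) (s^2) * qpoch_inf (s^2 * z) (s^2) * qpoch_inf z (s^2))) = ?P"
    proof -
      have "qpoch_inf s (s^2) = (1 - s) * qpoch_inf (s^3) (s^2)"
        using qpoch_inf_rec[of "s^2" s] s2 by (simp add: ze)
      thus ?thesis by (simp add: power2_eq_square mult_ac)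
    qed
    finally show ?thesis .
  qed
  ultimately show ?thesis by simp
qed

text \<open>The constant is 9 = 1 + 4 * 2. With u = s X and w = z X^2 one has s^2 X^4 >= u^4 and s z
  X^3 >= w^2, so the two quotients are at most (1 - u^4)/(1 - u) <= 4 and (1 - w^2)/(1 - w) <=
  2.\<close>

lemma acc_term_bound: "\<bar>acc_term s e z n\<bar> \<le> 9 * (1 / 3) ^ n"
proof -
  define X where "X = s ^ n"
  have X: "0 < X" "X \<le> 1" using s by (auto simp: X_def power_le_one)
  have sX: "s * X < 1" "0 < s * X" and zX: "z * X^2 < 1" "0 < z * X^2"
  proof -
    have "s * X \<le> s" "z * X^2 \<le> z" using s z X by (auto simp: mult_left_le power_le_one)
    thus "s * X < 1" "z * X^2 < 1" using s z_less_1 by linarith+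
    show "0 < s * X" "0 < z * X^2" using s z X by auto
  qed
  have a: "1 - u ^ 4 \<le> 4 * (1 - u)" if "0 < u" "u < 1" for u :: real
  proof -
    have "1 + u + u^2 + u^3 \<le> 4" using that power_le_one[of u 2] power_le_one[of u 3] by linarith
    hence "(1 + u + u^2 + u^3) * (1 - u) \<le> 4 * (1 - u)" using that by (intro mult_right_mono) auto
    thus ?thesis by (simp add: algebra_simps eval_nat_numeral)
  qed
  have "(s * X) ^ 4 \<le> s^2 * X^4" using s power_decreasing[of 2 4 s] X by (simp add: power_mult_distrib mult_right_mono)
  hence "1 - s^2 * X^4 \<le> 4 * (1 - s * X)" using a[OF sX(2,1)] by linarith
  moreover have "0 \<le> 1 - s^2 * X^4" using s X by (simp add: mult_le_one power_le_one)
  ultimately have 1: "\<bar>(1 - s^2 * X^4) / (1 - s * X)\<bar> \<le> 4" using sX by (simp add: divide_le_eq)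
  have "z * z * X ^ 4 \<le> s * z * X ^ 3" using s z X power_decreasing[of 3 4 X] by (intro mult_mono) auto
  moreover have "1 - z * z * X ^ 4 = (1 + z * X^2) * (1 - z * X^2)" by (simp add: algebra_simps eval_nat_numeral)
  moreover have "(1 + z * X^2) * (1 - z * X^2) \<le> 2 * (1 - z * X^2)" using zX by (intro mult_right_mono) auto
  ultimately have "1 - s * z * X^3 \<le> 2 * (1 - z * X^2)" by linarith
  moreover have "0 \<le> 1 - s * z * X^3" using s z z_less_1 X by (simp add: mult_le_one power_le_one)
  ultimately have 2: "\<bar>(1 - s * z * X^3) / (1 - z * X^2)\<bar> \<le> 2" using zX by (simp add: divide_le_eq)
  have 3: "\<bar>s * X^2\<bar> \<le> 1" using s X by (simp add: mult_le_one power_le_one)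
  have "\<bar>s * X^2 + ((1 - s^2 * X^4) / (1 - s * X)) * ((1 - s * z * X^3) / (1 - z * X^2))\<bar> \<le> 1 + 4 * 2"
    by (intro order_trans[OF abs_triangle_ineq] add_mono 3, unfold abs_mult, intro mult_mono 1 2) auto
  hence "\<bar>acc_coeff s e z n * (s * X^2 + ((1 - s^2 * X^4) / (1 - s * X)) * ((1 - s * z * X^3) / (1 - z * X^2)))\<bar> \<le> (1 / 3) ^ n * 9"
    unfolding abs_mult by (intro mult_mono acc_coeff_bound) auto
  thus ?thesis by (simp add: acc_term_def Let_def X_def mult_ac)
qed

end

section \<open>The limit of the product\<close>

text \<open>Convexity of sinh on the half line together with sinh 0 = 0.\<close>

lemma sinh_mult_le:
  fixes d x t :: real
  assumes "0 \<le> d" "d \<le> x" "0 < x" "0 \<le> t"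
  shows "sinh (d * t) \<le> d / x * sinh (x * t)"
proof -
  have "convex_on {0..} (sinh :: real \<Rightarrow> real)"
    by (rule f''_ge0_imp_convex[where f' = cosh and f'' = sinh]) (auto intro!: derivative_eq_intros)
  hence "sinh ((1 - d / x) *\<^sub>R 0 + (d / x) *\<^sub>R (x * t)) \<le> (1 - d / x) * sinh 0 + d / x * sinh (x * t)"
    using assms by (intro convex_onD) auto
  thus ?thesis using assms by simp
qed

text \<open>The prefactors q^(x/2) cancel in \<open>q_ratio_bounds\<close>, where x - d and x + d
  add up to 2 x.\<close>

lemma one_minus_powr_sinh:
  fixes q x :: real
  assumes "0 < q"
  shows "1 - q powr x = 2 * q powr (x / 2) * sinh (x * (- ln q / 2))"
proof -
  define u where "u = x * ln q / 2"
  have "exp u * exp u = exp (x * ln q)" by (simp add: u_def flip: exp_add)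
  moreover have "exp u * exp (- u) = 1" by (simp flip: exp_add)
  moreover have "sinh (- u) = (exp (- u) - exp u) / 2" by (simp add: sinh_field_def)
  moreover have "q powr (x / 2) = exp u" "q powr x = exp (x * ln q)" using assms by (simp_all add: powr_def u_def)
  moreover have "x * (- ln q / 2) = - u" by (simp add: u_def)
  ultimately show ?thesis by (simp add: algebra_simps)
qed

text \<open>Since sinh(u - v) sinh(u + v) = sinh(u)^2 - sinh(v)^2, the ratio is S^2 / (S^2 - D^2).
  It is at least 1, and D / S <= d / x bounds it by its value in the limit q -> 1.\<close>

lemma q_ratio_bounds:
  fixes q d x :: real
  assumes q: "0 < q" "q < 1" and d: "0 < d" "d < x"
  shows "1 \<le> (1 - q powr x)\<^sup>2 / ((1 - q powr (x - d)) * (1 - q powr (x + d)))"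
    and "(1 - q powr x)\<^sup>2 / ((1 - q powr (x - d)) * (1 - q powr (x + d))) \<le> x\<^sup>2 / ((x - d) * (x + d))"
proof -
  define t where "t = - ln q / 2"
  have t: "0 < t" using q by (simp add: t_def)
  define S where "S = sinh (x * t)"
  define D where "D = sinh (d * t)"
  have D: "0 < D" "D < S" using d t by (auto simp: D_def S_def)
  hence D2: "D^2 < S^2" by (intro power_strict_mono) auto
  have prod: "sinh ((x - d) * t) * sinh ((x + d) * t) = S^2 - D^2"
    by (simp add: S_def D_def ring_distribs sinh_add sinh_diff)
       (use cosh_square_eq[of "x * t"] cosh_square_eq[of "d * t"] in algebra)
  have pw: "(q powr (x / 2))\<^sup>2 = q powr ((x - d) / 2) * q powr ((x + d) / 2)"
    by (simp add: power2_eq_square flip: powr_add) (simp add: field_simps)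
  have "(1 - q powr x)\<^sup>2 = 4 * (q powr (x / 2))\<^sup>2 * S^2"
    unfolding one_minus_powr_sinh[OF q(1)] t_def[symmetric] S_def by (simp add: power_mult_distrib)
  moreover have "(1 - q powr (x - d)) * (1 - q powr (x + d)) = 4 * (q powr (x / 2))\<^sup>2 * (S^2 - D^2)"
    unfolding one_minus_powr_sinh[OF q(1)] t_def[symmetric] pw prod[symmetric] by (simp add: mult_ac)
  ultimately have eq: "(1 - q powr x)\<^sup>2 / ((1 - q powr (x - d)) * (1 - q powr (x + d))) = S^2 / (S^2 - D^2)"
    using q by simp
  show "1 \<le> (1 - q powr x)\<^sup>2 / ((1 - q powr (x - d)) * (1 - q powr (x + d)))"
    unfolding eq using D2 by simp
  have "D \<le> d / x * S" using sinh_mult_le[of d x t] d t by (simp add: D_def S_def)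
  hence "D^2 \<le> (d / x * S)^2" using D by (intro power_mono) auto
  hence "D^2 * x^2 \<le> d^2 * S^2" using d by (simp add: power_mult_distrib power_divide field_simps)
  hence "S^2 * (x^2 - d^2) \<le> x^2 * (S^2 - D^2)" by (simp add: algebra_simps)
  moreover have "0 < x^2 - d^2" using d by (simp add: power_strict_mono)
  ultimately have "S^2 / (S^2 - D^2) \<le> x^2 / (x^2 - d^2)" using D2 by (simp add: divide_simps mult_ac)
  moreover have "(x - d) * (x + d) = x^2 - d^2" by (simp add: algebra_simps power2_eq_square)
  ultimately show "(1 - q powr x)\<^sup>2 / ((1 - q powr (x - d)) * (1 - q powr (x + d))) \<le> x\<^sup>2 / ((x - d) * (x + d))"
    unfolding eq by simp
qed

section \<open>From q-numbers to Gamma values\<close>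

lemma one_minus_powr_over_one_minus_tendsto:
  fixes a :: real
  shows "((\<lambda>q. (1 - q powr a) / (1 - q)) \<longlongrightarrow> a) (at_left 1)"
proof -
  have "((\<lambda>q. q powr a) has_real_derivative a) (at 1)"
    by (rule DERIV_powr[of "\<lambda>q. q" _ 1 "\<lambda>_. a" 0, THEN DERIV_cong]) (auto intro!: derivative_eq_intros)
  hence "((\<lambda>q. (q powr a - 1) / (q - 1)) \<longlongrightarrow> a) (at 1)"
    by (simp add: has_field_derivative_iff)
  hence "((\<lambda>q. (q powr a - 1) / (q - 1)) \<longlongrightarrow> a) (at_left 1)"
    by (rule filterlim_mono) (auto simp: at_le)
  moreover have "(q powr a - 1) / (q - 1) = (1 - q powr a) / (1 - q)" for q :: real
    using minus_divide_divide[of "q powr a - 1" "q - 1"] by simp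
  ultimately show ?thesis by simp
qed

lemma q_number_ratio_tendsto:
  fixes a b :: real
  assumes "b \<noteq> 0"
  shows "((\<lambda>q. (1 - q powr a) / (1 - q powr b)) \<longlongrightarrow> a / b) (at_left 1)"
proof -
  have "((\<lambda>q. ((1 - q powr a) / (1 - q)) / ((1 - q powr b) / (1 - q))) \<longlongrightarrow> a / b) (at_left 1)"
    by (intro tendsto_divide one_minus_powr_over_one_minus_tendsto assms)
  moreover have "\<forall>\<^sub>F q in at_left 1. ((1 - q powr a) / (1 - q)) / ((1 - q powr b) / (1 - q)) = (1 - q powr a) / (1 - q powr b)"
    by (rule eventually_at_leftI[of 0]) auto
  ultimately show ?thesis by (rule Lim_transform_eventually)
qed

text \<open>Factorials and exponentials of \<open>Gamma_series'\<close> cancel because (c - d) + (c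
  + d) = 2 c; this variant has exactly n factors in its Pochhammer symbol, as the products over j <
  n require.\<close>

lemma pochhammer_quotient_LIMSEQ:
  fixes c d :: real
  assumes "0 < d" "d < c"
  shows "(\<lambda>n. (pochhammer c n)\<^sup>2 / (pochhammer (c - d) n * pochhammer (c + d) n))
           \<longlonglongrightarrow> Gamma (c - d) * Gamma (c + d) / (Gamma c)\<^sup>2"
proof -
  have "(\<lambda>n. Gamma_series' (c - d) n * Gamma_series' (c + d) n / (Gamma_series' c n)\<^sup>2)
           \<longlonglongrightarrow> Gamma (c - d) * Gamma (c + d) / (Gamma c)\<^sup>2"
    using assms by (intro tendsto_intros Gamma_series'_LIMSEQ) (auto simp: Gamma_eq_zero_iff elim!: nonpos_Ints_cases)
  moreover have "Gamma_series' (c - d) n * Gamma_series' (c + d) n / (Gamma_series' c n)\<^sup>2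
     = (pochhammer c n)\<^sup>2 / (pochhammer (c - d) n * pochhammer (c + d) n)" for n
  proof -
    have "exp ((c - d) * ln n) * exp ((c + d) * ln n) = (exp (c * ln n))\<^sup>2"
      by (simp add: power2_eq_square algebra_simps flip: exp_add)
    thus ?thesis by (simp add: Gamma_series'_def power2_eq_square field_simps)
  qed
  ultimately show ?thesis by simp
qed

theorem qpoch_inf_quotient_tendsto:
  fixes c d :: real
  assumes d: "0 < d" "d < c"
  shows "((\<lambda>q. (qpoch_inf (q powr c) q)\<^sup>2 / (qpoch_inf (q powr (c - d)) q * qpoch_inf (q powr (c + d)) q))
           \<longlongrightarrow> Gamma (c - d) * Gamma (c + d) / (Gamma c)\<^sup>2) (at_left 1)"
proof -
  define f where "f = (\<lambda>q x. (1 - q powr x)\<^sup>2 / ((1 - q powr (x - d)) * (1 - q powr (x + d))))"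
  define g where "g = (\<lambda>x::real. x\<^sup>2 / ((x - d) * (x + d)))"
  define R where "R = (\<lambda>q. (qpoch_inf (q powr c) q)\<^sup>2 / (qpoch_inf (q powr (c - d)) q * qpoch_inf (q powr (c + d)) q))"
  define L where "L = Gamma (c - d) * Gamma (c + d) / (Gamma c)\<^sup>2"
  have f_bounds: "1 \<le> f q (c + real j)" "f q (c + real j) \<le> g (c + real j)" if "0 < q" "q < 1" for q j
    using q_ratio_bounds[OF that, of d "c + real j"] d by (auto simp: f_def g_def)
  have L: "(\<lambda>n. \<Prod>j<n. g (c + real j)) \<longlonglongrightarrow> L"
  proof -
    have "(\<Prod>j<n. g (c + real j)) = (pochhammer c n)\<^sup>2 / (pochhammer (c - d) n * pochhammer (c + d) n)" for n
    proof -
      have "g (c + real j) = (c + real j)\<^sup>2 / ((c - d + real j) * (c + d + real j))" for j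
        by (simp add: g_def algebra_simps)
      thus ?thesis
        by (simp only: pochhammer_prod prod_dividef prod.distrib prod_power_distrib atLeast0LessThan)
    qed
    thus ?thesis using pochhammer_quotient_LIMSEQ[OF d] by (simp add: L_def)
  qed
  have R: "(\<lambda>n. \<Prod>j<n. f q (c + real j)) \<longlonglongrightarrow> R q" if q: "0 < q" "q < 1" for q
  proof -
    have "q ^ j * q powr x = q powr (x + real j)" for j x
      using q by (simp add: powr_add powr_realpow)
    moreover have "c + real j - d = c - d + real j" "c + real j + d = c + d + real j" for j
      by simp_all
    ultimately have "(\<Prod>j<n. f q (c + real j)) = (qpoch (q powr c) q n)\<^sup>2 / (qpoch (q powr (c - d)) q n * qpoch (q powr (c + d)) q n)" for n
      by (simp only: f_def qpoch_def prod_dividef prod.distrib prod_power_distrib)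
    moreover have "q powr (c - d) < 1" "q powr (c + d) < 1"
      using d by (simp_all add: powr01_less_one[OF q])
    hence "qpoch_inf (q powr (c - d)) q * qpoch_inf (q powr (c + d)) q \<noteq> 0"
      using q d by (intro no_zero_divisors less_imp_neq[symmetric] qpoch_inf_pos) auto
    ultimately show ?thesis
      using q unfolding R_def by (simp del: mult_eq_0_iff) (intro tendsto_intros qpoch_LIMSEQ, auto)
  qed
  have "(R \<longlongrightarrow> L) (at_left 1)"
  proof (rule order_tendstoI)
    \<comment> \<open>A finite product already exceeds a at q = 1, hence also for q near 1 by
      continuity, and R q is at least that product because all factors are at least 1.\<close>
    fix a assume "a < L"
    then obtain N where N: "a < (\<Prod>j<N. g (c + real j))"
      using order_tendstoD(1)[OF L] by (metis eventually_sequentially order_refl)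
    have "((\<lambda>q. \<Prod>j<N. f q (c + real j)) \<longlongrightarrow> (\<Prod>j<N. g (c + real j))) (at_left 1)"
    proof (rule tendsto_prod)
      fix j :: nat
      have "((\<lambda>q. ((1 - q powr (c + real j)) / (1 - q powr (c + real j - d))) * ((1 - q powr (c + real j)) / (1 - q powr (c + real j + d))))
         \<longlongrightarrow> ((c + real j) / (c + real j - d)) * ((c + real j) / (c + real j + d))) (at_left 1)"
        using d by (intro tendsto_mult q_number_ratio_tendsto) auto
      thus "((\<lambda>q. f q (c + real j)) \<longlongrightarrow> g (c + real j)) (at_left 1)"
        by (simp add: f_def g_def power2_eq_square)
    qed
    from order_tendstoD(1)[OF this N]
    have "\<forall>\<^sub>F q in at_left 1. a < (\<Prod>j<N. f q (c + real j))" .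
    moreover have "\<forall>\<^sub>F q in at_left 1. 0 < q \<and> q < (1::real)"
      by (rule eventually_at_leftI[of 0]) auto
    ultimately show "\<forall>\<^sub>F q in at_left 1. a < R q"
    proof eventually_elim
      case (elim q)
      have "incseq (\<lambda>n. \<Prod>j<n. f q (c + real j))"
      proof (rule incseq_SucI)
        fix n
        have "0 \<le> (\<Prod>j<n. f q (c + real j))"
          using f_bounds(1)[of q] elim by (intro prod_nonneg) (auto intro: order_trans[OF zero_le_one])
        from mult_left_mono[OF f_bounds(1)[of q n] this] show "(\<Prod>j<n. f q (c + real j)) \<le> (\<Prod>j<Suc n. f q (c + real j))"
          using elim by simp
      qed
      hence "(\<Prod>j<N. f q (c + real j)) \<le> R q" using R elim by (intro incseq_le) auto
      thus ?case using elim by simp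
    qed
  next
    \<comment> \<open>The upper bound R q <= L holds for every q in (0,1), by comparison factor by
      factor.\<close>
    fix a assume "L < a"
    have "\<forall>\<^sub>F q in at_left 1. 0 < q \<and> q < (1::real)"
      by (rule eventually_at_leftI[of 0]) auto
    thus "\<forall>\<^sub>F q in at_left 1. R q < a"
    proof eventually_elim
      case (elim q)
      have "(\<Prod>j<n. f q (c + real j)) \<le> (\<Prod>j<n. g (c + real j))" for n
        using f_bounds[of q] elim by (intro prod_mono) (auto intro: order_trans[OF zero_le_one])
      hence "R q \<le> L" using LIMSEQ_le[OF R[of q] L] elim by blast
      thus ?case using \<open>L < a\<close> by simp
    qed
  qed
  thus ?thesis by (simp add: R_def L_def)
qed

section \<open>The series in terms of the sixth root of q\<close>

text \<open>Six is the common denominator of the exponents 1/2, 1/3, 2/3, 7/6 and their kin, so with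
  q = v^6 real powers become natural powers of v.\<close>

lemma power6_powr:
  fixes v r :: real
  assumes "0 < v" "6 * r = real m"
  shows "(v ^ 6) powr r = v ^ m"
proof -
  have "(v ^ 6) powr r = v powr (real 6 * r)"
    by (simp only: powr_realpow[OF assms(1), symmetric] powr_powr)
  also have "\<dots> = v powr real m" using assms(2) by simp
  also have "\<dots> = v ^ m" using assms(1) by (rule powr_realpow)
  finally show ?thesis .
qed

text \<open>The coefficients are compared by induction through their consecutive ratios; the
  expression in braces is translated directly.\<close>

lemma q_term_eq_acc_term:
  fixes v :: real
  assumes v: "0 < v" "v < 1"
  shows "q_term (v ^ 6) n = acc_term (v ^ 3) (v ^ 2) (v ^ 4) n"
proof -
  define s where "s = v ^ 3"
  define e where "e = v ^ 2"
  define z where "z = v ^ 4"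
  define q where "q = v ^ 6"
  note pw = power6_powr[OF v(1), folded q_def]
  have fixed: "q powr (1/2) = s" "q powr (1/3) = e" "q powr (2/3) = z" "q powr (5/3) = s\<^sup>2 * z" "q powr (3/2) = s ^ 3" "q = s\<^sup>2"
    using pw[of "1/2" 3] pw[of "1/3" 2] pw[of "2/3" 4] pw[of "5/3" 10] pw[of "3/2" 9]
    by (simp_all add: s_def e_def z_def q_def flip: power_mult power_add)
  have coeff: "(-1) ^ n * (qpochs [s, q, z] s n * qpoch s q n * qpoch e q n)
     / (qpoch z q n * qpoch (s\<^sup>2 * z) q n * qpoch (s ^ 3) s (3 * n) * (1 + s))
     * q powr (real n * (9 * real n + 11) / 12) = acc_coeff s e z n" for n
  proof (induction n)
    case 0
    have "q \<noteq> 0" using v by (simp add: q_def)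
    thus ?case by (simp add: acc_coeff_def qpochs_def)
  next
    case (Suc n)
    define X where "X = s ^ n"
    have qn: "q ^ n = X\<^sup>2" by (simp add: X_def fixed(6) power_mult[symmetric] mult.commute)
    have q3: "qpoch (s ^ 3) s (3 * Suc n) = qpoch (s ^ 3) s (3 * n) * ((1 - s^3 * X^3) * (1 - s^4 * X^3) * (1 - s^5 * X^3))"
    proof -
      have "s ^ (3 * n) = X ^ 3" by (simp add: X_def power_mult[symmetric] mult.commute)
      thus ?thesis by (simp add: qpoch_Suc eval_nat_numeral mult_ac)
    qed
    \<comment> \<open>The quadratic exponent enters through its increment 3n/2 + 5/3, and six times
      this is the natural number 9n + 10.\<close>
    have "q powr (real (Suc n) * (9 * real (Suc n) + 11) / 12) =
          q powr (real n * (9 * real n + 11) / 12 + (3 / 2 * real n + 5 / 3))"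
      by (rule arg_cong[of _ _ "\<lambda>x. q powr x"]) (simp add: algebra_simps add_divide_distrib)
    also have "\<dots> = q powr (real n * (9 * real n + 11) / 12) * v ^ (9 * n + 10)"
      by (subst powr_add, subst pw[of "3 / 2 * real n + 5 / 3" "9 * n + 10"]) simp_all
    also have "v ^ (9 * n + 10) = s\<^sup>2 * z * X ^ 3"
      by (simp add: X_def s_def z_def flip: power_mult power_add) (simp add: mult.commute add.commute)
    finally have qp: "q powr (real (Suc n) * (9 * real (Suc n) + 11) / 12)
        = q powr (real n * (9 * real n + 11) / 12) * (s\<^sup>2 * z * X ^ 3)" .
    have "acc_coeff s e z (Suc n) = acc_coeff s e z n *
     (- ((1 - s * X) * (1 - s^2 * X) * (1 - z * X) * (1 - s * X^2) * (1 - e * X^2) * (s^2 * z * X^3))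
     / ((1 - z * X^2) * (1 - s^2 * z * X^2) * (1 - s^3 * X^3) * (1 - s^4 * X^3) * (1 - s^5 * X^3)))"
      by (simp add: acc_coeff_def Let_def X_def)
    also note Suc.IH[symmetric]
    finally show ?case
      unfolding q3 qp by (simp add: qpochs_def qpoch_Suc qn X_def[symmetric] fixed(6)[symmetric] mult_ac)
  qed
  define X where "X = s ^ n"
  have var: "q powr (real n + 1/2) = s * X^2" "q powr (3/2 * real n + 7/6) = s * z * X^3"
     "q powr (real n / 2 + 1/2) = s * X" "q powr (real n + 2/3) = z * X^2" "q ^ (2 * n + 1) = s^2 * X^4"
    using pw[of "real n + 1/2" "6 * n + 3"] pw[of "3/2 * real n + 7/6" "9 * n + 7"]
      pw[of "real n / 2 + 1/2" "3 * n + 3"] pw[of "real n + 2/3" "6 * n + 4"]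
    by (simp_all add: X_def s_def z_def q_def algebra_simps flip: power_mult power_add power_Suc)
  show ?thesis
    using coeff[of n] unfolding q_term_def q_def[symmetric] s_def[symmetric] e_def[symmetric] z_def[symmetric] fixed(1-5) var
    by (simp add: acc_term_def Let_def X_def)
qed

lemma nome_conditions:
  fixes v :: real
  assumes v: "0 < v" "v < 1"
  shows "0 < v ^ 3" "v ^ 3 < 1" "0 < v ^ 2" "v ^ 2 < 1" "0 < v ^ 4" "v ^ 4 \<le> v ^ 3" "(v ^ 3) ^ 5 \<le> v ^ 4"
    "v ^ 2 * v ^ 4 = (v ^ 3)\<^sup>2"
proof -
  show "v ^ 4 \<le> v ^ 3" using v by (intro power_decreasing) auto
  have "v ^ 15 \<le> v ^ 4" using v by (intro power_decreasing) auto
  thus "(v ^ 3) ^ 5 \<le> v ^ 4" by (simp flip: power_mult)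
qed (use v in \<open>simp_all add: power_less_one_iff flip: power_mult power_add\<close>)

lemma sixth_root_between:
  fixes q :: real
  assumes "0 < q" "q < 1"
  obtains v where "0 < v" "v < 1" "q = v ^ 6"
proof
  show "0 < root 6 q" "root 6 q < 1" "q = root 6 q ^ 6"
    using assms by auto
qed

lemma q_term_sums_q_product:
  assumes "0 < q" "q < 1"
  shows "q_term q sums q_product q"
proof -
  obtain v where v: "0 < v" "v < 1" "q = v ^ 6"
    using sixth_root_between assms by blast
  note pw = power6_powr[OF v(1), folded v(3)]
  have fixed: "q powr (1/2) = v ^ 3" "q powr (2/3) = v ^ 4" "q powr (5/3) = (v ^ 3)\<^sup>2 * v ^ 4" "q powr (3/2) = (v ^ 3) ^ 3"
     "q powr (7/6) = v ^ 3 * v ^ 4" "q = (v ^ 3)\<^sup>2"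
    using pw[of "1/2" 3] pw[of "2/3" 4] pw[of "5/3" 10] pw[of "3/2" 9] pw[of "7/6" 7]
    by (simp_all add: v(3) flip: power_mult power_add)
  have "q_term q = acc_term (v ^ 3) (v ^ 2) (v ^ 4)"
    using q_term_eq_acc_term[OF v(1,2)] by (auto simp: v(3))
  moreover have "q_product q = (qpoch_inf ((v^3)\<^sup>2) ((v^3)\<^sup>2))\<^sup>2 * (qpoch_inf (v^3 * v^4) ((v^3)\<^sup>2))\<^sup>2
      / (qpoch_inf (v^3) ((v^3)\<^sup>2) * qpoch_inf ((v^3) ^ 3) ((v^3)\<^sup>2) * qpoch_inf (v^4) ((v^3)\<^sup>2) * qpoch_inf ((v^3)\<^sup>2 * v^4) ((v^3)\<^sup>2))"
    unfolding q_product_def fixed(1-5) unfolding fixed(6) by simp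
  ultimately show ?thesis
    using acc_term_sums[OF nome_conditions[OF v(1,2)]] by simp
qed

lemma q_term_bound:
  assumes "0 < q" "q < 1"
  shows "\<bar>q_term q n\<bar> \<le> 9 * (1 / 3) ^ n"
proof -
  obtain v where v: "0 < v" "v < 1" "q = v ^ 6"
    using sixth_root_between assms by blast
  show ?thesis
    using acc_term_bound[OF nome_conditions[OF v(1,2)]] q_term_eq_acc_term[OF v(1,2)] by (simp add: v(3))
qed

section \<open>Limits as q tends to 1\<close>

lemma power_ratio_tendsto:
  assumes "b \<noteq> 0"
  shows "((\<lambda>v::real. (1 - v ^ a) / (1 - v ^ b)) \<longlongrightarrow> real a / real b) (at_left 1)"
proof (rule Lim_transform_eventually)
  show "((\<lambda>v. (1 - v powr real a) / (1 - v powr real b)) \<longlongrightarrow> real a / real b) (at_left 1)"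
    using assms by (intro q_number_ratio_tendsto) auto
  show "\<forall>\<^sub>F v in at_left 1. (1 - v powr real a) / (1 - v powr real b) = (1 - v ^ a) / (1 - v ^ b)"
    by (rule eventually_at_leftI[of 0]) (auto simp: powr_realpow)
qed

text \<open>The limit arises with (2)_n / (2/3)_n. Rewriting this by (1)_n and (5/3)_n produces (n +
  1)(3n + 2)/2, and 1/(1 + s) tends to 1/2: hence the factor 4. The polynomial later clears the
  denominators of the expression in braces.\<close>

lemma acc_coeff_tendsto:
  "((\<lambda>v. 4 * acc_coeff (v ^ 3) (v ^ 2) (v ^ 4) n) \<longlongrightarrow>
     (-1/27) ^ n * (pochhammer 1 n * pochhammer (1/2) n * pochhammer (1/3) n) / (pochhammer (5/3) n) ^ 3
     * ((real n + 1) * (3 * real n + 2))) (at_left 1)"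
    (is "(_ \<longlongrightarrow> ?K n * _) _")
proof (induction n)
  case 0
  have "((\<lambda>v::real. 4 / (1 + v ^ 3)) \<longlongrightarrow> 4 / (1 + 1 ^ 3)) (at_left 1)"
    by (intro tendsto_intros) auto
  thus ?case by (simp add: acc_coeff_def)
next
  case (Suc n)
  \<comment> \<open>Minus \<open>r\<close> is the ratio of consecutive coefficients, with factors
    grouped into quotients that have finite limits.\<close>
  define r where "r = (\<lambda>v::real.
       ((1 - v ^ (3*n+3)) / (1 - v ^ (9*n+9))) * ((1 - v ^ (3*n+6)) / (1 - v ^ (9*n+12))) * ((1 - v ^ (3*n+4)) / (1 - v ^ (9*n+15)))
     * ((1 - v ^ (6*n+3)) / (1 - v ^ (6*n+4))) * ((1 - v ^ (6*n+2)) / (1 - v ^ (6*n+10))) * v ^ (9*n+10))"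
  have "(r \<longlongrightarrow> (real (3*n+3) / real (9*n+9)) * (real (3*n+6) / real (9*n+12)) * (real (3*n+4) / real (9*n+15))
     * (real (6*n+3) / real (6*n+4)) * (real (6*n+2) / real (6*n+10)) * 1 ^ (9*n+10)) (at_left 1)"
    unfolding r_def by (intro tendsto_mult power_ratio_tendsto tendsto_power tendsto_ident_at) auto
  from tendsto_mult[OF Suc.IH tendsto_minus[OF this]]
  have lim: "((\<lambda>v. 4 * acc_coeff (v ^ 3) (v ^ 2) (v ^ 4) n * - r v) \<longlongrightarrow> ?K (Suc n) * ((real (Suc n) + 1) * (3 * real (Suc n) + 2))) (at_left 1)"
  proof (rule tendsto_eq_rhs)
    have p: "pochhammer (5/3 :: real) n \<noteq> 0" by (simp add: pochhammer_eq_0_iff)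
    have n: "3 * real n + 2 \<noteq> 0" "3 * real n + 5 \<noteq> 0" "3 * real n + 4 \<noteq> 0" "real n + 1 \<noteq> 0" by linarith+
    have 1: "- (real (3*n+3) / real (9*n+9) * (real (3*n+6) / real (9*n+12)) * (real (3*n+4) / real (9*n+15)) *
       (real (6*n+3) / real (6*n+4)) * (real (6*n+2) / real (6*n+10)) * 1 ^ (9*n+10))
        = - ((2 * real n + 1) * (3 * real n + 1) * (real n + 2)) / (6 * (3 * real n + 5)^2 * (3 * real n + 2))"
    proof -
      have a: "real (3*n+3) / real (9*n+9) = 1 / 3" "real (3*n+6) / real (9*n+12) = (real n + 2) / (3 * real n + 4)"
        "real (3*n+4) / real (9*n+15) = (3 * real n + 4) / (3 * (3 * real n + 5))"
        "real (6*n+3) / real (6*n+4) = 3 * (2 * real n + 1) / (2 * (3 * real n + 2))"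
        "real (6*n+2) / real (6*n+10) = (3 * real n + 1) / (3 * real n + 5)"
        using n by (simp_all add: divide_simps) (simp_all add: algebra_simps)
      show ?thesis unfolding a using n by (simp add: power2_eq_square divide_simps) (simp add: algebra_simps)
    qed
    have 2: "?K (Suc n) = ?K n * (- ((real n + 1) * (2 * real n + 1) * (3 * real n + 1)) / (6 * (3 * real n + 5)^3))"
    proof -
      have e: "1/2 + real n = (2 * real n + 1) / 2" "1/3 + real n = (3 * real n + 1) / 3" "5/3 + real n = (3 * real n + 5) / 3" by simp_all
      show ?thesis
        unfolding pochhammer_Suc e using p n by (simp add: power_mult_distrib power_divide mult_ac)
    qed
    show "?K n * ((real n + 1) * (3 * real n + 2)) * - (real (3*n+3) / real (9*n+9) * (real (3*n+6) / real (9*n+12)) * (real (3*n+4) / real (9*n+15)) *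
       (real (6*n+3) / real (6*n+4)) * (real (6*n+2) / real (6*n+10)) * 1 ^ (9*n+10)) = ?K (Suc n) * ((real (Suc n) + 1) * (3 * real (Suc n) + 2))"
    proof -
      have "K * (a * b) * (- (c * d * g) / (6 * h^2 * b)) = K * (- (a * c * d) / (6 * h^3)) * (g * h)"
        if "b \<noteq> 0" "h \<noteq> 0" for K a b c d g h :: real
        using that by (simp add: eval_nat_numeral mult_ac)
      from this[OF n(1,2), of "?K n" "real n + 1" "2 * real n + 1" "3 * real n + 1" "real n + 2"]
      show ?thesis unfolding 1 2 by (simp add: algebra_simps)
    qed
  qed
  have "4 * acc_coeff (v ^ 3) (v ^ 2) (v ^ 4) n * - r v = 4 * acc_coeff (v ^ 3) (v ^ 2) (v ^ 4) (Suc n)" for v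
  proof -
    have X: "v ^ 3 * (v^3)^n = v ^ (3*n+3)" "(v^3)^2 * (v^3)^n = v ^ (3*n+6)" "v^4 * (v^3)^n = v ^ (3*n+4)"
      "v^3 * ((v^3)^n)^2 = v^(6*n+3)" "v^2 * ((v^3)^n)^2 = v^(6*n+2)" "(v^3)^2 * v^4 * ((v^3)^n)^3 = v^(9*n+10)"
      "v^4 * ((v^3)^n)^2 = v^(6*n+4)" "(v^3)^2 * v^4 * ((v^3)^n)^2 = v^(6*n+10)"
      "(v^3)^3 * ((v^3)^n)^3 = v^(9*n+9)" "(v^3)^4 * ((v^3)^n)^3 = v^(9*n+12)" "(v^3)^5 * ((v^3)^n)^3 = v^(9*n+15)"
      by (simp_all add: add.commute flip: power_mult power_add)
    show ?thesis
      unfolding acc_coeff_def prod.lessThan_Suc Let_def X r_def by (simp add: mult_ac)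
  qed
  from lim[unfolded this] show ?case .
qed

lemma q_term_tendsto:
  "((\<lambda>q. 4 * q_term q n) \<longlongrightarrow> classical_term n) (at_left 1)"
proof -
  define K where "K = (-1/27 :: real) ^ n * (pochhammer 1 n * pochhammer (1/2) n * pochhammer (1/3) n) / (pochhammer (5/3) n) ^ 3"
  define B where "B = (\<lambda>v::real. v ^ (6*n+3) + ((1 - v ^ (12*n+6)) / (1 - v ^ (3*n+3))) * ((1 - v ^ (9*n+7)) / (1 - v ^ (6*n+4))))"
  have "(B \<longlongrightarrow> 1 ^ (6*n+3) + (real (12*n+6) / real (3*n+3)) * (real (9*n+7) / real (6*n+4))) (at_left 1)"
    unfolding B_def by (intro tendsto_mult tendsto_add power_ratio_tendsto tendsto_power tendsto_ident_at) auto
  from tendsto_mult[OF acc_coeff_tendsto[of n, folded K_def] this]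
  have "((\<lambda>v. 4 * acc_coeff (v ^ 3) (v ^ 2) (v ^ 4) n * B v) \<longlongrightarrow> classical_term n) (at_left 1)"
  proof (rule tendsto_eq_rhs)
    have n: "real n + 1 \<noteq> 0" "3 * real n + 2 \<noteq> 0" by linarith+
    have "real (12*n+6) / real (3*n+3) = 2 * (2 * real n + 1) / (real n + 1)"
         "real (9*n+7) / real (6*n+4) = (9 * real n + 7) / (2 * (3 * real n + 2))"
      using n by (simp_all add: divide_simps) (simp_all add: algebra_simps)
    \<comment> \<open>The quadratic of the theorem is (n + 1)(3n + 2) + (2n + 1)(9n + 7).\<close>
    moreover have "((real n + 1) * (3 * real n + 2)) * (1 ^ (6*n+3) + (2 * (2 * real n + 1) / (real n + 1)) * ((9 * real n + 7) / (2 * (3 * real n + 2))))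
        = 9 + 28 * real n + 21 * (real n)\<^sup>2"
      using n by (simp add: divide_simps) (simp add: algebra_simps power2_eq_square)
    ultimately show "K * ((real n + 1) * (3 * real n + 2)) * (1 ^ (6*n+3) + (real (12*n+6) / real (3*n+3)) * (real (9*n+7) / real (6*n+4))) = classical_term n"
      by (simp add: classical_term_def K_def)
  qed
  moreover have "4 * acc_coeff (v ^ 3) (v ^ 2) (v ^ 4) n * B v = 4 * acc_term (v ^ 3) (v ^ 2) (v ^ 4) n" for v
  proof -
    have X: "v^3 * ((v^3)^n)^2 = v^(6*n+3)" "(v^3)^2 * ((v^3)^n)^4 = v^(12*n+6)" "v^3 * v^4 * ((v^3)^n)^3 = v^(9*n+7)"
      "v ^ 3 * (v^3)^n = v ^ (3*n+3)" "v^4 * ((v^3)^n)^2 = v^(6*n+4)"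
      by (simp_all add: add.commute flip: power_mult power_add)
    show ?thesis
      unfolding acc_term_def Let_def X B_def by simp
  qed
  ultimately have lim: "((\<lambda>v. 4 * acc_term (v ^ 3) (v ^ 2) (v ^ 4) n) \<longlongrightarrow> classical_term n) (at_left 1)" by simp
  \<comment> \<open>The limit was computed in v; to pass to q, the sixth root must approach 1 from
    below as well.\<close>
  have "filterlim (root 6) (at_left 1) (at_left (1::real))"
    unfolding filterlim_at
  proof (intro conjI)
    have "isCont (root 6) (1::real)" by (rule isCont_real_root)
    thus "(root 6 \<longlongrightarrow> 1) (at_left (1::real))"
      using filterlim_at_split[of "root 6" "nhds 1" "1::real"] by (simp add: isCont_def)
    show "\<forall>\<^sub>F q in at_left 1. root 6 q \<in> {..<1} \<and> root 6 q \<noteq> (1::real)"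
      by (rule eventually_at_leftI[of 0]) auto
  qed
  from filterlim_compose[OF lim this]
  have "((\<lambda>q. 4 * acc_term (root 6 q ^ 3) (root 6 q ^ 2) (root 6 q ^ 4) n) \<longlongrightarrow> classical_term n) (at_left 1)" .
  moreover have "\<forall>\<^sub>F q in at_left 1. 4 * acc_term (root 6 q ^ 3) (root 6 q ^ 2) (root 6 q ^ 4) n = 4 * q_term q n"
  proof (rule eventually_at_leftI[of 0])
    fix q :: real assume "q \<in> {0<..<1}"
    thus "4 * acc_term (root 6 q ^ 3) (root 6 q ^ 2) (root 6 q ^ 4) n = 4 * q_term q n"
      using q_term_eq_acc_term[of "root 6 q" n] by simp
  qed simp
  ultimately show ?thesis by (rule Lim_transform_eventually)
qed

text \<open>The cases c = 1 and c = 7/6 with d = 1/2 of \<open>qpoch_inf_quotient_tendsto\<close>.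
  Reducing Gamma at 3/2, 5/3 and 7/6 by the functional equation gives 48 = 4 * (1/2) * (2/3) *
  36.\<close>

lemma q_product_tendsto:
  "((\<lambda>q. 4 * q_product q) \<longlongrightarrow> 48 * pi * (Gamma (2/3))\<^sup>2 / (Gamma (1/6))\<^sup>2) (at_left 1)"
proof -
  define R where "R = (\<lambda>c q. (qpoch_inf (q powr c) q)\<^sup>2 / (qpoch_inf (q powr (c - 1/2)) q * qpoch_inf (q powr (c + 1/2)) q))"
  have G: "Gamma (3/2 :: real) = sqrt pi / 2" "Gamma (5/3 :: real) = 2/3 * Gamma (2/3)" "Gamma (7/6 :: real) = 1/6 * Gamma (1/6)"
  proof -
    have "x \<notin> \<int>\<^sub>\<le>\<^sub>0" if "0 < x" for x :: real
      using that by (auto elim!: nonpos_Ints_cases)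
    thus "Gamma (3/2 :: real) = sqrt pi / 2" "Gamma (5/3 :: real) = 2/3 * Gamma (2/3)" "Gamma (7/6 :: real) = 1/6 * Gamma (1/6)"
      using Gamma_plus1[of "1/2 :: real"] Gamma_plus1[of "2/3 :: real"] Gamma_plus1[of "1/6 :: real"]
      by (simp_all add: Gamma_one_half_real)
  qed
  have "((\<lambda>q. 4 * (R 1 q * R (7/6) q)) \<longlongrightarrow> 4 * ((Gamma (1 - 1/2) * Gamma (1 + 1/2) / (Gamma 1)\<^sup>2) *
       (Gamma (7/6 - 1/2) * Gamma (7/6 + 1/2) / (Gamma (7/6))\<^sup>2))) (at_left 1)"
    unfolding R_def by (intro tendsto_mult tendsto_const qpoch_inf_quotient_tendsto) auto
  hence "((\<lambda>q. 4 * (R 1 q * R (7/6) q)) \<longlongrightarrow> 48 * pi * (Gamma (2/3))\<^sup>2 / (Gamma (1/6))\<^sup>2) (at_left 1)"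
  proof (rule tendsto_eq_rhs)
    show "4 * ((Gamma (1 - 1/2) * Gamma (1 + 1/2) / (Gamma 1)\<^sup>2) *
       (Gamma (7/6 - 1/2) * Gamma (7/6 + 1/2) / (Gamma (7/6))\<^sup>2)) = 48 * pi * (Gamma (2/3))\<^sup>2 / (Gamma (1/6 :: real))\<^sup>2"
      by (simp add: G Gamma_one_half_real power2_eq_square)
  qed
  moreover have "\<forall>\<^sub>F q in at_left 1. 4 * (R 1 q * R (7/6) q) = 4 * q_product q"
    by (rule eventually_at_leftI[of 0]) (auto simp: R_def q_product_def mult_ac)
  ultimately show ?thesis by (rule Lim_transform_eventually)
qed

text \<open>The second and third conjuncts make the limiting case precise: the two sides of (i),
  scaled by 4, tend to the two sides of (ii).\<close>

theorem mainTheorem8: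
  shows "(\<forall>q::real. 0 < q \<and> q < 1 \<longrightarrow> q_term q sums q_product q)
    \<and> ((\<lambda>q. 4 * q_product q) \<longlongrightarrow> 48 * pi * (Gamma (2/3))\<^sup>2 / (Gamma (1/6))\<^sup>2) (at_left 1)
    \<and> ((\<lambda>q. 4 * (\<Sum>n. q_term q n)) \<longlongrightarrow> (\<Sum>n. classical_term n)) (at_left 1)
    \<and> classical_term sums (48 * pi * (Gamma (2/3))\<^sup>2 / (Gamma (1/6))\<^sup>2)"
proof -
  have ev: "\<forall>\<^sub>F q in at_left 1. 0 < q \<and> q < (1::real)"
    by (rule eventually_at_leftI[of 0]) auto
  have "eventually (\<lambda>(n, q). norm (4 * q_term q n) \<le> 36 * (1 / 3) ^ n) (at_top \<times>\<^sub>F at_left 1)"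
  proof (rule eventually_mono[OF eventually_prodI[OF always_eventually ev]])
    show "\<forall>n::nat. True" by simp
    fix x :: "nat \<times> real" assume "True \<and> 0 < snd x \<and> snd x < 1"
    thus "case x of (n, q) \<Rightarrow> norm (4 * q_term q n) \<le> 36 * (1 / 3) ^ n"
      using q_term_bound[of "snd x" "fst x"] by (auto simp: case_prod_beta abs_mult)
  qed
  moreover have "summable (\<lambda>n. 36 * (1 / 3 :: real) ^ n)"
    by (intro summable_mult summable_geometric) auto
  ultimately have tannery: "summable (\<lambda>n. norm (classical_term n)) \<and>
      ((\<lambda>q. \<Sum>n. 4 * q_term q n) \<longlongrightarrow> suminf classical_term) (at_left 1)"
    using tannerys_theorem[OF q_term_tendsto, where M = "\<lambda>n. 36 * (1 / 3) ^ n"] by simp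
  have eqs: "\<forall>\<^sub>F q in at_left 1. (\<Sum>n. 4 * q_term q n) = 4 * (\<Sum>n. q_term q n) \<and> (\<Sum>n. 4 * q_term q n) = 4 * q_product q"
    using ev
  proof eventually_elim
    case (elim q)
    thus ?case using q_term_sums_q_product[of q] by (auto simp: sums_iff suminf_mult)
  qed
  have lim: "((\<lambda>q. 4 * (\<Sum>n. q_term q n)) \<longlongrightarrow> suminf classical_term) (at_left 1)"
    by (rule Lim_transform_eventually[OF conjunct2[OF tannery]]) (use eqs in eventually_elim, auto)
  have "((\<lambda>q. 4 * q_product q) \<longlongrightarrow> suminf classical_term) (at_left 1)"
    by (rule Lim_transform_eventually[OF conjunct2[OF tannery]]) (use eqs in eventually_elim, auto)
  \<comment> \<open>By (i) the scaled sum and the scaled product are the same function of q, so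
    uniqueness of limits evaluates the classical series.\<close>
  hence "suminf classical_term = 48 * pi * (Gamma (2/3))\<^sup>2 / (Gamma (1/6))\<^sup>2"
    using q_product_tendsto by (intro tendsto_unique[OF trivial_limit_at_left_real])
  moreover have "summable classical_term" using tannery summable_norm_cancel by blast
  ultimately have "classical_term sums (48 * pi * (Gamma (2/3))\<^sup>2 / (Gamma (1/6))\<^sup>2)"
    by (simp add: sums_iff)
  thus ?thesis using q_term_sums_q_product q_product_tendsto lim by blast
qed

end
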